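(* Let $d\ge 5$ and let $Q$ be a non-degenerate, real symmetric $d\times d$ matrix of block-type. Fix real numbers $a<b$ and a vector $M\in\mathbb{R}^d$. For $r>0$ let $$H_{r,M}=\{x\in\mathbb{R}^d:\ a\le Q[x-M]\le b,\ |x|_\infty\le r\}$$ and $$\Delta(r,M)=\Bigl|\frac{\#(H_{r,M}\cap\mathbb{Z}^d)-\operatorname{vol}H_{r,M}}{\operatorname{vol}H_{r,M}}\Bigr| .$$ Then $\Delta(r,M)=\mathcal{O}(1)$ as $r\to\infty$.
   Context: $Q[x]=\langle Qx,x\rangle$ for $x\in\mathbb{R}^d$; non-degenerate means all eigenvalues of $Q$ are nonzero. $Q$ is of block-type if $Q[x]=Q^+[x]-Q^-[x]$ where $Q^+$, $Q^-$ are positive definite quadratic forms, $Q^+[x]$ depends only on the first $d_1$ coordinates of $x$ and $Q^-[x]$ only on the remaining $d-d_1$ coordinates. $|x|_\infty$ is the maximum norm, $\operatorname{vol}$ is Lebesgue measure, $\#(B\cap\mathbb Z^d)$ is the number of integer points in $B$. *)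

theory Defs
  imports "HOL-Analysis.Analysis" "HOL-Library.Landau_Symbols"
begin

definition quad :: "real^'n^'n \<Rightarrow> real^'n \<Rightarrow> real" where
  "quad Q x = (Q *v x) \<bullet> x"

definition symmetric_matrix :: "real^'n^'n \<Rightarrow> bool" where
  "symmetric_matrix Q \<longleftrightarrow> transpose Q = Q"

definition eigenvalue_of :: "real^'n^'n \<Rightarrow> real \<Rightarrow> bool" where
  "eigenvalue_of Q c \<longleftrightarrow> (\<exists>v. v \<noteq> 0 \<and> Q *v v = c *\<^sub>R v)"

text \<open>Only real eigenvalues are considered; for the symmetric matrices to which
  this is applied there are no others.\<close>

definition nondegenerate :: "real^'n^'n \<Rightarrow> bool" where
  "nondegenerate Q \<longleftrightarrow> (\<forall>c. eigenvalue_of Q c \<longrightarrow> c \<noteq> 0)"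

text \<open>The linear order on the index type numbers the coordinates, so that
  \<open>first_coords k\<close> consists of the \<open>k\<close> smallest indices.\<close>

definition first_coords :: "nat \<Rightarrow> 'n::{finite,linorder} set" where
  "first_coords k = {i. card {j. j < i} < k}"

definition depends_only_on :: "(real^'n \<Rightarrow> real) \<Rightarrow> 'n set \<Rightarrow> bool" where
  "depends_only_on f S \<longleftrightarrow> (\<forall>x y. (\<forall>i\<in>S. x $ i = y $ i) \<longrightarrow> f x = f y)"

text \<open>Positive definiteness of a form that depends only on the coordinates in \<open>S\<close>,
  regarded as a form in these coordinates.\<close>

definition pos_definite_in :: "(real^'n \<Rightarrow> real) \<Rightarrow> 'n set \<Rightarrow> bool" where
  "pos_definite_in f S \<longleftrightarrow> (\<forall>x. (\<exists>i\<in>S. x $ i \<noteq> 0) \<longrightarrow> f x > 0)"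

text \<open>The extreme values \<open>d1 = 0\<close> and \<open>d1 = d\<close>, i.e. definite \<open>Q\<close>, are not excluded.\<close>

definition block_type :: "real^('n::{finite,linorder})^('n::{finite,linorder}) \<Rightarrow> bool" where
  "block_type Q \<longleftrightarrow>
     (\<exists>d1 \<le> CARD('n). \<exists>Qp Qm :: real^('n::{finite,linorder})^('n::{finite,linorder}).
        symmetric_matrix Qp \<and> symmetric_matrix Qm \<and>
        depends_only_on (quad Qp) (first_coords d1) \<and>
        depends_only_on (quad Qm) (- first_coords d1) \<and>
        pos_definite_in (quad Qp) (first_coords d1) \<and>
        pos_definite_in (quad Qm) (- first_coords d1) \<and>
        (\<forall>x. quad Q x = quad Qp x - quad Qm x))"

definition integer_points :: "(real^'n) set" where
  "integer_points = {x. \<forall>i. x $ i \<in> \<int>}"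

definition shell :: "real^'n^'n \<Rightarrow> real \<Rightarrow> real \<Rightarrow> real^'n \<Rightarrow> real \<Rightarrow> (real^'n) set" where
  "shell Q a b M r = {x. a \<le> quad Q (x - M) \<and> quad Q (x - M) \<le> b \<and> infnorm x \<le> r}"

definition discrepancy :: "real^'n^'n \<Rightarrow> real \<Rightarrow> real \<Rightarrow> real^'n \<Rightarrow> real \<Rightarrow> real" where
  "discrepancy Q a b M r =
     \<bar>(real (card (shell Q a b M r \<inter> integer_points)) - measure lebesgue (shell Q a b M r))
        / measure lebesgue (shell Q a b M r)\<bar>"

end

theory Submission
  imports Defs
begin

text \<open>
  If \<open>Q\<close> is definite, the shell does not depend on \<open>r\<close> for large \<open>r\<close>. Otherwise its volume is at least
  a constant times \<open>r\<^bsup>d-2\<^esup>\<close>, since \<open>O(r\<^sup>2)\<close> translates of it along a positive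
  direction cover a ball of radius comparable to \<open>r\<close>; and it contains \<open>O(r\<^bsup>d-2\<^esup>)\<close> integer points
  by the following form of the circle method.

  Detecting \<open>a \<le> Q[x - M] \<le> b\<close> with \<open>R\<^sup>2\<close> equidistant frequencies \<open>s\<close> in a bounded interval reduces the
  count to an average of \<open>|\<theta>(s)|\<close>, where \<open>\<theta>\<close> runs over points \<open>x + y\<close> with \<open>x, y\<close> in cubes. The phase is
  bilinear in \<open>(x, y)\<close> up to unimodular factors, so the large sieve bounds \<open>|\<theta>(s)|\<^sup>2\<close> by \<open>R\<^bsup>3d\<^esup>\<close> times the number
  of integer pairs \<open>(h, k)\<close> with \<open>|h| \<le> R\<close>, \<open>|sQh - k| \<le> 1/R\<close> up to constants. These pairs span an isotropic
  subspace, because the symplectic form is integral and smaller than 1 on them; hence their number is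
  \<open>O(\<mu>\<^bsup>-d\<^esup>)\<close> with \<open>\<mu>\<close> the length of the shortest one after rescaling.

  The block structure enters when the frequencies with shortest length below \<open>\<mu>\<close> are counted. One may take
  \<open>h\<close> in a single block, where \<open>Q\<close> is definite, so that finitely many cones cover all directions and
  \<open>|\<langle>Qh, h'\<rangle>|\<close> is comparable to \<open>|h||h'|\<close> within a cone. If \<open>s, s'\<close> are two such frequencies, the integer
  \<open>\<langle>k, h'\<rangle> - \<langle>k', h\<rangle>\<close> is close to \<open>(s - s')\<langle>Qh, h'\<rangle>\<close>; for nearby \<open>s, s'\<close> it vanishes, which forces them to be
  much closer. Hence the proportion of these frequencies is \<open>O(\<mu>\<^sup>2)\<close>, and the dyadic sum of \<open>\<mu>\<^sup>2 \<mu>\<^bsup>-d/2\<^esup>\<close> down to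
  \<open>\<mu> = 1/R\<close> is \<open>O(R\<^bsup>d/2-2\<^esup>)\<close> exactly because \<open>d > 4\<close>.
\<close>

section \<open>Packing in isotropic subspaces\<close>

text \<open>The balls of radius \<open>\<mu>/2\<close> around the points of \<open>F\<close> are
  disjoint and lie in the ball of radius \<open>\<rho> + \<mu>/2\<close> around 0. In the comparison
  of volumes the measure of the unit ball cancels.\<close>

lemma separated_card_le:
  fixes F :: "'a::euclidean_space set"
  assumes "finite F" "0 < \<mu>" "0 \<le> \<rho>"
    and norm: "\<And>x. x \<in> F \<Longrightarrow> norm x \<le> \<rho>"
    and sep: "\<And>x y. x \<in> F \<Longrightarrow> y \<in> F \<Longrightarrow> x \<noteq> y \<Longrightarrow> \<mu> \<le> norm (x - y)"
  shows "real (card F) \<le> ((2 * \<rho> + \<mu>) / \<mu>) ^ DIM('a)"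
proof -
  let ?v = "measure lborel (ball (0::'a) 1)"
  have v: "?v > 0"
    by (rule content_ball_pos) simp
  have disj: "disjoint_family_on (\<lambda>x. ball x (\<mu>/2)) F"
    unfolding disjoint_family_on_def
  proof (intro ballI impI)
    fix x y assume xy: "x \<in> F" "y \<in> F" "x \<noteq> y"
    show "ball x (\<mu>/2) \<inter> ball y (\<mu>/2) = {}"
    proof (rule ccontr)
      assume "ball x (\<mu>/2) \<inter> ball y (\<mu>/2) \<noteq> {}"
      then obtain z where "dist x z < \<mu>/2" "dist y z < \<mu>/2" by auto
      then have "dist x y < \<mu>"
        using dist_triangle_half_r[of z x \<mu> y] by (simp add: dist_commute)
      then show False using sep[OF xy] by (simp add: dist_norm)
    qed
  qed
  have "real (card F) * ((\<mu>/2) ^ DIM('a) * ?v) = (\<Sum>x\<in>F. measure lborel (ball x (\<mu>/2)))"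
    using assms(2) by (simp add: content_ball_conv_unit_ball[of "\<mu>/2"])
  also have "\<dots> = measure lborel (\<Union>x\<in>F. ball x (\<mu>/2))"
    using emeasure_lborel_ball_finite
    by (intro measure_UNION'[symmetric] assms)
       (use disj in \<open>auto simp: fmeasurable_def disjoint_family_on_def pairwise_def disjnt_def\<close>)
  also have "\<dots> \<le> measure lborel (ball (0::'a) (\<rho> + \<mu>/2))"
  proof (rule measure_mono_fmeasurable)
    show "(\<Union>x\<in>F. ball x (\<mu>/2)) \<subseteq> ball 0 (\<rho> + \<mu>/2)"
    proof
      fix z assume "z \<in> (\<Union>x\<in>F. ball x (\<mu>/2))"
      then obtain x where x: "x \<in> F" "dist x z < \<mu>/2" by auto
      have "norm z \<le> norm x + dist x z"
        by (metis dist_norm norm_minus_commute norm_triangle_sub)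
      then show "z \<in> ball 0 (\<rho> + \<mu>/2)" using x norm[OF x(1)] by simp
    qed
    show "ball (0::'a) (\<rho> + \<mu>/2) \<in> fmeasurable lborel"
      using emeasure_lborel_ball_finite[of 0 "\<rho> + \<mu>/2"] by (auto simp: fmeasurable_def)
  qed (use assms in auto)
  also have "\<dots> = (\<rho> + \<mu>/2) ^ DIM('a) * ?v"
    using assms by (intro content_ball_conv_unit_ball) auto
  finally have "real (card F) * (\<mu>/2) ^ DIM('a) \<le> (\<rho> + \<mu>/2) ^ DIM('a)"
    using v by simp
  then have "real (card F) \<le> (\<rho> + \<mu>/2) ^ DIM('a) / (\<mu>/2) ^ DIM('a)"
    using assms(2) by (simp add: pos_le_divide_eq)
  also have "\<dots> = ((\<rho> + \<mu>/2) / (\<mu>/2)) ^ DIM('a)"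
    by (rule power_divide[symmetric])
  also have "(\<rho> + \<mu>/2) / (\<mu>/2) = (2 * \<rho> + \<mu>) / \<mu>"
    using assms(2) by (simp add: field_simps)
  finally show ?thesis .
qed

text \<open>Isotropy says exactly that \<open>W\<close> is orthogonal to its image under the
  injective rotation \<open>f\<close>, so twice the dimension of \<open>W\<close> fits into a space
  of dimension 2d.\<close>

lemma dim_isotropic_le:
  fixes W :: "((real^'n) \<times> (real^'n)) set"
  assumes iso: "\<And>v w. v \<in> W \<Longrightarrow> w \<in> W \<Longrightarrow> fst v \<bullet> snd w = snd v \<bullet> fst w"
  shows "dim W \<le> CARD('n)"
proof -
  define f :: "(real^'n) \<times> (real^'n) \<Rightarrow> (real^'n) \<times> (real^'n)" where "f = (\<lambda>v. (- snd v, fst v))"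
  have lin: "linear f"
    by (rule linearI) (auto simp: f_def)
  have inj: "inj f"
    by (auto simp: f_def inj_on_def prod_eq_iff)
  have "dim (W \<union> f ` W) = dim W + dim (f ` W)"
    by (rule dim_orthogonal_sum) (use iso in \<open>auto simp: f_def inner_prod_def\<close>)
  moreover have "dim (f ` W) = dim W"
    using lin inj by (intro dim_image_eq) (auto intro: inj_on_subset)
  moreover have "dim (W \<union> f ` W) \<le> 2 * CARD('n)"
    using dim_subset_UNIV[of "W \<union> f ` W"] by simp
  ultimately show ?thesis by simp
qed

text \<open>The span of \<open>F\<close> embeds isometrically into \<open>real^'n\<close>, and the
  packing takes place there. This gives the exponent d instead of the 2d of the ambient
  space.\<close>

lemma separated_isotropic_card_le:
  fixes F :: "((real^'n) \<times> (real^'n)) set"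
  assumes "finite F" "0 < \<mu>" "0 \<le> \<rho>"
    and norm: "\<And>x. x \<in> F \<Longrightarrow> norm x \<le> \<rho>"
    and sep: "\<And>x y. x \<in> F \<Longrightarrow> y \<in> F \<Longrightarrow> x \<noteq> y \<Longrightarrow> \<mu> \<le> norm (x - y)"
    and iso: "\<And>v w. v \<in> F \<Longrightarrow> w \<in> F \<Longrightarrow> fst v \<bullet> snd w = snd v \<bullet> fst w"
  shows "real (card F) \<le> ((2 * \<rho> + \<mu>) / \<mu>) ^ CARD('n)"
proof -
  have "dim (span F) \<le> dim (UNIV :: (real^'n) set)"
    using dim_isotropic_le[OF iso] by (simp add: dim_span)
  then obtain f :: "_ \<Rightarrow> real^'n"
    where f: "linear f" "\<And>x. x \<in> span F \<Longrightarrow> norm (f x) = norm x"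
    using isometry_subset_subspace[OF subspace_span[of F] subspace_UNIV] by metis
  have diff: "norm (f x - f y) = norm (x - y)" if "x \<in> F" "y \<in> F" for x y
    using f that by (metis linear_diff span_base span_diff)
  have inj: "inj_on f F"
  proof (rule inj_onI)
    fix x y assume "x \<in> F" "y \<in> F" "f x = f y"
    then show "x = y" using diff[of x y] by simp
  qed
  have "real (card (f ` F)) \<le> ((2 * \<rho> + \<mu>) / \<mu>) ^ DIM(real^'n)"
  proof (rule separated_card_le)
    fix x assume "x \<in> f ` F"
    then show "norm x \<le> \<rho>" using norm f(2) span_base by (metis imageE)
  next
    fix x y assume "x \<in> f ` F" "y \<in> f ` F" "x \<noteq> y"
    then obtain u v where "u \<in> F" "v \<in> F" "x = f u" "y = f v" "u \<noteq> v" by blast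
    then show "\<mu> \<le> norm (x - y)" using diff[of u v] sep[of u v] by simp
  qed (use assms in auto)
  then show ?thesis using card_image[OF inj] by simp
qed

section \<open>Exponential sums over integer grids\<close>

definition grid :: "int set \<Rightarrow> (real^'n) set" where
  "grid L = {v. \<forall>j. v $ j \<in> of_int ` L}"

lemma grid_bij:
  "bij_betw (\<lambda>f. \<chi> j. of_int (f j)) (PiE UNIV (\<lambda>_. L)) (grid L :: (real^'n) set)"
proof (rule bij_betw_imageI)
  show "inj_on (\<lambda>f. (\<chi> j. of_int (f j)) :: real^'n) (PiE UNIV (\<lambda>_. L))"
    by (auto simp: inj_on_def vec_eq_iff)
  show "(\<lambda>f. (\<chi> j. of_int (f j)) :: real^'n) ` PiE UNIV (\<lambda>_. L) = grid L"
  proof (intro equalityI subsetI)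
    fix v :: "real^'n" assume "v \<in> grid L"
    then have "\<forall>j. \<exists>l\<in>L. v $ j = of_int l" by (auto simp: grid_def)
    then obtain f where "\<And>j. f j \<in> L \<and> v $ j = of_int (f j)" by metis
    then show "v \<in> (\<lambda>f. (\<chi> j. of_int (f j))) ` PiE UNIV (\<lambda>_. L)"
      by (intro image_eqI[of _ _ f]) (auto simp: vec_eq_iff)
  qed (auto simp: grid_def PiE_iff)
qed

lemma finite_grid: "finite L \<Longrightarrow> finite (grid L :: (real^'n) set)"
  using bij_betw_finite[OF grid_bij, of L] by (auto intro: finite_PiE)

lemma grid_mono: "L \<subseteq> L' \<Longrightarrow> grid L \<subseteq> grid L'"
  unfolding grid_def by blast

lemma card_grid: "card (grid L :: (real^'n) set) = card L ^ CARD('n)"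
  by (simp flip: bij_betw_same_card[OF grid_bij] add: card_PiE)

lemma sum_grid_prod:
  fixes f :: "'n::finite \<Rightarrow> real \<Rightarrow> 'c::comm_semiring_1"
  assumes "finite L"
  shows "(\<Sum>v\<in>grid L. \<Prod>j\<in>UNIV. f j (v $ j)) = (\<Prod>j\<in>UNIV. \<Sum>l\<in>L. f j (of_int l))"
  using sum.reindex_bij_betw[OF grid_bij, of "\<lambda>v. \<Prod>j\<in>UNIV. f j (v $ j)" L] assms
  by (simp add: prod_sum_PiE)

section \<open>Geometric sums in one variable\<close>

lemma cis_sum: "cis (sum f A) = (\<Prod>x\<in>A. cis (f x))"
  by (induction A rule: infinite_finite_induct) (auto simp: cis_mult[symmetric])

text \<open>The crude bound pi < 4 keeps |y| <= 2 for y = pi x. Then |sin y - y| <= |y|^3/6 leaves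
  |sin y| >= |y|/3, and pi > 3 absorbs the factor 3.\<close>

lemma abs_sin_pi_ge:
  fixes x :: real
  assumes "\<bar>x\<bar> \<le> 1/2"
  shows "\<bar>x\<bar> \<le> \<bar>sin (pi * x)\<bar>"
proof -
  let ?y = "pi * x"
  have "\<bar>?y\<bar> \<le> 4 * (1/2)"
    unfolding abs_mult using assms pi_less_4 by (intro mult_mono) auto
  then have "?y\<^sup>2 \<le> 2\<^sup>2"
    by (intro abs_le_square_iff[THEN iffD1]) auto
  then have y3: "\<bar>?y\<bar> ^ 3 \<le> 4 * \<bar>?y\<bar>"
    using mult_right_mono[of "?y\<^sup>2" 4 "\<bar>?y\<bar>"] by (simp add: power3_eq_cube power2_eq_square)
  have "\<bar>sin ?y - (\<Sum>m<3. sin_coeff m * ?y ^ m)\<bar> \<le> inverse (fact 3) * \<bar>?y\<bar> ^ 3"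
    by (rule Maclaurin_sin_bound)
  moreover have "(\<Sum>m<3. sin_coeff m * ?y ^ m) = ?y"
    by (simp add: numeral_3_eq_3 sin_coeff_def)
  ultimately have "\<bar>sin ?y - ?y\<bar> \<le> \<bar>?y\<bar> ^ 3 / 6"
    by (simp add: fact_numeral)
  then have "\<bar>sin ?y\<bar> \<ge> \<bar>?y\<bar> / 3"
    using y3 by linarith
  moreover have "\<bar>?y\<bar> \<ge> 3 * \<bar>x\<bar>"
    unfolding abs_mult using pi_gt3 by (intro mult_right_mono) auto
  ultimately show ?thesis by linarith
qed

lemma norm_cis_minus_1: "norm (cis x - 1) = 2 * \<bar>sin (x/2)\<bar>"
proof -
  have "cis x - 1 = cis (x/2) * (2 * \<i> * complex_of_real (sin (x/2)))"
    using sin_double[of "x/2"] cos_double_sin[of "x/2"]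
    by (simp add: complex_eq_iff power2_eq_square)
  then show ?thesis by (simp add: norm_mult)
qed

text \<open>The geometric series gives |S| <= 1/|rho|, where rho is the signed distance of
  \<open>\<beta>\<close> to its nearest integer, besides the trivial |S| <= N. Stating the bound
  through the integer nearest to N rho allows frequencies to be grouped into cells of length 1/N,
  with weights that are summable over the cells.\<close>

lemma norm_exp_sum_sq_le:
  fixes \<beta> :: real and N :: nat
  assumes "N > 0"
  shows "(norm (\<Sum>l\<in>{0..<int N}. cis (2 * pi * (\<beta> * of_int l))))\<^sup>2
          \<le> 8 * (real N)\<^sup>2 / (1 + (of_int (round (real N * (\<beta> - of_int (round \<beta>)))))\<^sup>2)"
proof -
  define k where "k = round \<beta>"
  define \<rho> where "\<rho> = \<beta> - of_int k"
  define l where "l = round (real N * \<rho>)"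
  define S where "S = (\<Sum>l\<in>{0..<int N}. cis (2 * pi * (\<beta> * of_int l)))"
  have \<rho>: "\<bar>\<rho>\<bar> \<le> 1/2"
    using of_int_round_abs_le[of \<beta>] by (simp add: \<rho>_def k_def abs_minus_commute)
  have l: "\<bar>of_int l - real N * \<rho>\<bar> \<le> 1/2"
    unfolding l_def by (rule of_int_round_abs_le)
  have trivial: "norm S \<le> real N"
    unfolding S_def by (rule order.trans[OF norm_sum]) simp
  have "(norm S)\<^sup>2 \<le> 8 * (real N)\<^sup>2 / (1 + (of_int l)\<^sup>2)"
  proof (cases "l = 0")
    case True
    have "(norm S)\<^sup>2 \<le> (real N)\<^sup>2"
      using trivial by (intro power_mono) auto
    also have "\<dots> \<le> 8 * (real N)\<^sup>2" by simp
    finally show ?thesis using True by simp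
  next
    case False
    define z where "z = cis (2 * pi * \<rho>)"
    have l1: "1 \<le> \<bar>real_of_int l\<bar>" using False by linarith
    \<comment> \<open>Rounding moves N rho by at most 1/2, which is at most |l|/2 because
      \<open>l\<close> is a nonzero integer.\<close>
    have N\<rho>: "\<bar>real_of_int l\<bar> \<le> 2 * (real N * \<bar>\<rho>\<bar>)"
    proof -
      have "\<bar>real N * \<rho>\<bar> = real N * \<bar>\<rho>\<bar>" by (simp add: abs_mult)
      then show ?thesis using l l1 by linarith
    qed
    then have \<rho>0: "\<bar>\<rho>\<bar> > 0" using l1 by (cases "\<rho> = 0") auto
    have "norm (z - 1) = 2 * \<bar>sin (pi * \<rho>)\<bar>"
      unfolding z_def norm_cis_minus_1 by simp
    then have z1: "2 * \<bar>\<rho>\<bar> \<le> norm (z - 1)" using abs_sin_pi_ge[OF \<rho>] by simp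
    then have zne: "z \<noteq> 1" using \<rho>0 by auto
    have "S = (\<Sum>n<N. cis (2 * pi * (\<beta> * real n)))"
      unfolding S_def
      by (rule sum.reindex_bij_witness[of _ int nat]) auto
    also have "\<dots> = (\<Sum>n<N. z ^ n)"
    proof (rule sum.cong)
      fix n
      have "2 * pi * (\<beta> * real n) = real n * (2 * pi * \<rho>) + 2 * pi * of_int (k * int n)"
        by (simp add: \<rho>_def algebra_simps)
      then have "cis (2 * pi * (\<beta> * real n)) = cis (real n * (2 * pi * \<rho>)) * cis (2 * pi * of_int (k * int n))"
        by (simp only: cis_mult)
      also have "cis (2 * pi * of_int (k * int n)) = 1"
        by (rule cis_multiple_2pi) simp
      finally show "cis (2 * pi * (\<beta> * real n)) = z ^ n"
        by (simp only: z_def Complex.DeMoivre mult_1_right)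
    qed simp
    also have "\<dots> = (z ^ N - 1) / (z - 1)"
      using zne by (rule geometric_sum)
    finally have "norm S = norm (z ^ N - 1) / norm (z - 1)" by (simp add: norm_divide)
    also have "\<dots> \<le> 2 / (2 * \<bar>\<rho>\<bar>)"
    proof (rule frac_le)
      show "norm (z ^ N - 1) \<le> 2"
        using norm_triangle_ineq4[of "z^N" 1] by (simp add: z_def norm_power)
    qed (use z1 \<rho>0 in auto)
    finally have "norm S * \<bar>\<rho>\<bar> \<le> 1" using \<rho>0 by (simp add: pos_le_divide_eq)
    then have "norm S * \<bar>real_of_int l\<bar> \<le> 2 * real N"
      using mult_left_mono[OF N\<rho>, of "norm S"]
        mult_left_mono[of "norm S * \<bar>\<rho>\<bar>" 1 "2 * real N"] by (simp add: mult_ac)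
    then have "(norm S * \<bar>real_of_int l\<bar>)\<^sup>2 \<le> (2 * real N)\<^sup>2"
      by (intro power_mono) auto
    then have 1: "(norm S)\<^sup>2 * (of_int l)\<^sup>2 \<le> 4 * (real N)\<^sup>2"
      by (simp add: power_mult_distrib)
    have "1 \<le> (real_of_int l)\<^sup>2" using one_le_power[OF l1, of 2] by simp
    then have "(norm S)\<^sup>2 * (1 + (of_int l)\<^sup>2) \<le> (norm S)\<^sup>2 * (2 * (of_int l)\<^sup>2)"
      by (intro mult_left_mono) auto
    then have "(norm S)\<^sup>2 * (1 + (of_int l)\<^sup>2) \<le> 8 * (real N)\<^sup>2"
      using 1 by simp
    moreover have "0 < 1 + (real_of_int l)\<^sup>2" by (simp add: add_pos_nonneg)
    ultimately show ?thesis by (simp add: pos_le_divide_eq)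
  qed
  then show ?thesis by (simp add: S_def l_def \<rho>_def k_def)
qed

lemma sum_inverse_1_plus_sq_le:
  fixes L :: "int set"
  assumes "finite L"
  shows "(\<Sum>l\<in>L. 1 / (1 + (real_of_int l)\<^sup>2)) \<le> 5"
proof -
  \<comment> \<open>The term -4/(n+1) makes the induction close: the two new summands together are
    at most the telescoping difference 4/(n+1) - 4/(n+2).\<close>
  have *: "(\<Sum>l\<in>{- int n..int n}. 1 / (1 + (real_of_int l)\<^sup>2)) \<le> 5 - 4 / (real n + 1)" for n
  proof (induction n)
    case 0
    then show ?case by simp
  next
    case (Suc n)
    have "{- int (Suc n)..int (Suc n)} = insert (- int (Suc n)) (insert (int (Suc n)) {- int n..int n})"
      by auto
    then have "(\<Sum>l\<in>{- int (Suc n)..int (Suc n)}. 1 / (1 + (real_of_int l)\<^sup>2))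
        = 2 / (1 + (real n + 1)\<^sup>2) + (\<Sum>l\<in>{- int n..int n}. 1 / (1 + (real_of_int l)\<^sup>2))"
      by (simp add: power2_eq_square algebra_simps)
    also have "2 / (1 + (real n + 1)\<^sup>2) \<le> 4 / (real n + 1) - 4 / (real n + 2)"
    proof -
      have "4 / (real n + 1) - 4 / (real n + 2) = 4 / ((real n + 1) * (real n + 2))"
        by (simp add: field_simps)
      moreover have "2 / (1 + (real n + 1)\<^sup>2) = 4 / (2 * (1 + (real n + 1)\<^sup>2))"
        by (simp only: divide_divide_eq_left[symmetric])
      moreover have "\<dots> \<le> 4 / ((real n + 1) * (real n + 2))"
        by (rule divide_left_mono) (auto simp: power2_eq_square algebra_simps add_pos_nonneg)
      ultimately show ?thesis by (simp only:)
    qed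
    finally show ?case using Suc by (simp add: add.commute)
  qed
  obtain n :: nat where n: "\<And>l. l \<in> L \<Longrightarrow> \<bar>l\<bar> \<le> int n"
  proof -
    have "\<exists>n. \<forall>l\<in>L. nat \<bar>l\<bar> \<le> n"
      using assms by (metis finite_imageI finite_nat_set_iff_bounded_le imageI)
    then show ?thesis using that by (meson nat_le_iff)
  qed
  have "(\<Sum>l\<in>L. 1 / (1 + (real_of_int l)\<^sup>2)) \<le> (\<Sum>l\<in>{- int n..int n}. 1 / (1 + (real_of_int l)\<^sup>2))"
    using n by (intro sum_mono2) (force simp: abs_le_iff add_nonneg_nonneg)+
  also have "\<dots> \<le> 5 - 4 / (real n + 1)" by (rule *)
  also have "\<dots> \<le> 5" by simp
  finally show ?thesis .
qed

text \<open>The points are grouped by the vector of their cells. Each cell holds at most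
  \<open>K\<close> of them, and the total weight of all cells factors into one sum per coordinate,
  each at most 8 N^2 * 5.\<close>

lemma sum_prod_exp_sum_le:
  fixes g :: "'a \<Rightarrow> real^'n"
  assumes "finite X" "N > 0"
    and K: "\<And>c::'n \<Rightarrow> int.
      real (card {x \<in> X. \<forall>j. round (real N * (g x $ j - of_int (round (g x $ j)))) = c j}) \<le> K"
  shows "(\<Sum>x\<in>X. \<Prod>j\<in>UNIV. (norm (\<Sum>l\<in>{0..<int N}. cis (2 * pi * (g x $ j * of_int l))))\<^sup>2)
          \<le> K * (40 * (real N)\<^sup>2) ^ CARD('n)"
proof -
  define cell where "cell = (\<lambda>x j. round (real N * (g x $ j - of_int (round (g x $ j)))))"
  define F where "F = (\<lambda>l. 8 * (real N)\<^sup>2 / (1 + (real_of_int l)\<^sup>2))"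
  define L where "L = (\<Union>j. (\<lambda>x. cell x j) ` X)"
  have F0: "F l \<ge> 0" for l by (simp add: F_def add_nonneg_nonneg)
  have L: "finite L" using assms(1) by (simp add: L_def)
  have "0 \<le> real (card {x \<in> X. \<forall>j. round (real N * (g x $ j - of_int (round (g x $ j)))) = (\<lambda>_. 0) j})"
    by simp
  then have K0: "K \<ge> 0" using K[of "\<lambda>_. 0"] by linarith
  have "(\<Sum>x\<in>X. \<Prod>j\<in>UNIV. (norm (\<Sum>l\<in>{0..<int N}. cis (2 * pi * (g x $ j * of_int l))))\<^sup>2)
      \<le> (\<Sum>x\<in>X. \<Prod>j\<in>UNIV. F (cell x j))"
    unfolding F_def cell_def using norm_exp_sum_sq_le[OF assms(2)]
    by (intro sum_mono prod_mono) auto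
  also have "\<dots> = (\<Sum>c\<in>cell ` X. \<Sum>x\<in>{x \<in> X. cell x = c}. \<Prod>j\<in>UNIV. F (cell x j))"
    using assms(1) by (rule sum.image_gen)
  also have "\<dots> = (\<Sum>c\<in>cell ` X. real (card {x \<in> X. cell x = c}) * (\<Prod>j\<in>UNIV. F (c j)))"
    by (intro sum.cong) auto
  also have "\<dots> \<le> (\<Sum>c\<in>cell ` X. K * (\<Prod>j\<in>UNIV. F (c j)))"
    using K by (intro sum_mono mult_right_mono prod_nonneg) (auto simp: F0 cell_def fun_eq_iff)
  also have "\<dots> = K * (\<Sum>c\<in>cell ` X. \<Prod>j\<in>UNIV. F (c j))"
    by (simp add: sum_distrib_left)
  also have "\<dots> \<le> K * (\<Sum>c\<in>PiE (UNIV::'n set) (\<lambda>_. L). \<Prod>j\<in>UNIV. F (c j))"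
  proof -
    have "finite (PiE (UNIV::'n set) (\<lambda>_. L))" using L by (intro finite_PiE) auto
    moreover have "cell ` X \<subseteq> PiE UNIV (\<lambda>_. L)" by (auto simp: L_def PiE_iff)
    ultimately have "(\<Sum>c\<in>cell ` X. \<Prod>j\<in>UNIV. F (c j)) \<le> (\<Sum>c\<in>PiE (UNIV::'n set) (\<lambda>_. L). \<Prod>j\<in>UNIV. F (c j))"
      by (rule sum_mono2) (auto intro!: prod_nonneg F0)
    then show ?thesis using K0 by (rule mult_left_mono)
  qed
  also have "\<dots> = K * (\<Prod>j\<in>(UNIV::'n set). \<Sum>l\<in>L. F l)"
    using L by (subst prod_sum_PiE) auto
  also have "\<dots> \<le> K * (40 * (real N)\<^sup>2) ^ CARD('n)"
  proof -
    have "(\<Sum>l\<in>L. F l) = 8 * (real N)\<^sup>2 * (\<Sum>l\<in>L. 1 / (1 + (real_of_int l)\<^sup>2))"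
      by (simp add: F_def sum_distrib_left)
    also have "\<dots> \<le> 8 * (real N)\<^sup>2 * 5"
      by (intro mult_left_mono sum_inverse_1_plus_sq_le L) auto
    finally have "(\<Sum>l\<in>L. F l) \<le> 40 * (real N)\<^sup>2" by simp
    then have "(\<Sum>l\<in>L. F l) ^ CARD('n) \<le> (40 * (real N)\<^sup>2) ^ CARD('n)"
      by (rule power_mono) (intro sum_nonneg F0)
    from mult_left_mono[OF this K0] show ?thesis by (simp only: prod_constant)
  qed
  finally show ?thesis .
qed

section \<open>The large sieve on grids\<close>

lemma sum_grid_cis_norm_sq:
  fixes \<beta> :: "real^'n"
  assumes "finite L"
  shows "(norm (\<Sum>p\<in>grid L. cis (2 * pi * (\<beta> \<bullet> p))))\<^sup>2
          = (\<Prod>j\<in>UNIV. (norm (\<Sum>l\<in>L. cis (2 * pi * (\<beta> $ j * of_int l))))\<^sup>2)"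
proof -
  have "(\<Sum>p\<in>grid L. cis (2 * pi * (\<beta> \<bullet> p)))
      = (\<Sum>p\<in>grid L. \<Prod>j\<in>UNIV. cis (2 * pi * (\<beta> $ j * p $ j)))"
    by (simp add: inner_vec_def sum_distrib_left cis_sum)
  also have "\<dots> = (\<Prod>j\<in>UNIV. \<Sum>l\<in>L. cis (2 * pi * (\<beta> $ j * of_int l)))"
    by (rule sum_grid_prod[OF assms])
  finally show ?thesis by (simp add: prod_norm[symmetric] prod_power_distrib)
qed

text \<open>The sum over \<open>y\<close> is majorized by a sum over differences p - q of points of
  a larger cube. Expanding the square then produces squared Dirichlet kernels at the differences of
  the frequencies \<open>g x\<close>. They are controlled by the number of frequencies in a cell
  relative to a given one, which is what \<open>K\<close> bounds.\<close>

lemma large_sieve_grid: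
  fixes g :: "'a \<Rightarrow> real^'n" and a :: "'a \<Rightarrow> complex"
  assumes "finite X" "2 * R < N"
    and a: "\<And>x. x \<in> X \<Longrightarrow> norm (a x) \<le> 1"
    and K: "\<And>y (c::'n \<Rightarrow> int). y \<in> X \<Longrightarrow>
      real (card {x \<in> X. \<forall>j. round (real N * ((g x - g y) $ j - of_int (round ((g x - g y) $ j)))) = c j}) \<le> K"
  shows "(real N - 2 * real R) ^ CARD('n)
           * (\<Sum>y\<in>grid {- int R..int R}. (norm (\<Sum>x\<in>X. a x * cis (2 * pi * (g x \<bullet> y))))\<^sup>2)
         \<le> real (card X) * K * (40 * (real N)\<^sup>2) ^ CARD('n)"
proof -
  define A where "A = (\<lambda>y. \<Sum>x\<in>X. a x * cis (2 * pi * (g x \<bullet> y)))"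
  define B :: "(real^'n) set" where "B = grid {- int R..int R}"
  define P :: "(real^'n) set" where "P = grid {0..<int N}"
  define P' :: "(real^'n) set" where "P' = grid {int R..<int N - int R}"
  define D where "D = (\<lambda>\<beta>. \<Sum>p\<in>P. cis (2 * pi * (\<beta> \<bullet> p)))"
  have fin: "finite B" "finite P" "finite P'"
    by (simp_all add: B_def P_def P'_def finite_grid)
  have "card P' = (N - 2 * R) ^ CARD('n)"
    unfolding P'_def card_grid using assms(2) by (simp add: nat_diff_distrib nat_mult_distrib)
  then have cP': "real (card P') = (real N - 2 * real R) ^ CARD('n)"
    using assms(2) by simp
  \<comment> \<open>Each \<open>y\<close> in \<open>B\<close> is the difference of
    \<open>y + q\<close> in \<open>P\<close> and \<open>q\<close> for every \<open>q\<close> in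
    \<open>P'\<close>, the cube \<open>P\<close> shrunk by \<open>R\<close> on each side. This gives
    (N - 2R)^d representations of every \<open>y\<close>.\<close>
  have "(real N - 2 * real R) ^ CARD('n) * (\<Sum>y\<in>B. (norm (A y))\<^sup>2)
      = (\<Sum>(y, q)\<in>B \<times> P'. (norm (A y))\<^sup>2)"
    by (simp add: sum.cartesian_product[symmetric] cP' sum_distrib_left)
  also have "\<dots> = (\<Sum>(p, q)\<in>(\<lambda>(y, q). (y + q, q)) ` (B \<times> P'). (norm (A (p - q)))\<^sup>2)"
    by (subst sum.reindex) (auto simp: inj_on_def intro!: sum.cong)
  also have "\<dots> \<le> (\<Sum>(p, q)\<in>P \<times> P. (norm (A (p - q)))\<^sup>2)"
  proof (rule sum_mono2)
    show "(\<lambda>(y, q). (y + q, q)) ` (B \<times> P') \<subseteq> P \<times> P"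
    proof safe
      fix y q :: "real^'n" assume yq: "y \<in> B" "q \<in> P'"
      have "P' \<subseteq> P"
        unfolding P_def P'_def by (rule grid_mono) auto
      then show "q \<in> P" using yq(2) by blast
      show "y + q \<in> P"
        unfolding P_def grid_def
      proof (rule CollectI, rule allI)
        fix j
        obtain l m where "y $ j = of_int l" "l \<in> {- int R..int R}"
          "q $ j = of_int m" "m \<in> {int R..<int N - int R}"
          using yq unfolding B_def P'_def grid_def by blast
        then show "(y + q) $ j \<in> of_int ` {0..<int N}"
          by (intro image_eqI[of _ _ "l + m"]) auto
      qed
    qed
  qed (use fin in auto)
  also have "\<dots> = (\<Sum>p\<in>P. \<Sum>q\<in>P. (norm (A (p - q)))\<^sup>2)"
    by (simp add: sum.cartesian_product)
  finally have 1: "(real N - 2 * real R) ^ CARD('n) * (\<Sum>y\<in>B. (norm (A y))\<^sup>2)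
      \<le> (\<Sum>p\<in>P. \<Sum>q\<in>P. (norm (A (p - q)))\<^sup>2)" .
  \<comment> \<open>A character evaluated at p - q splits into a factor in p and a conjugate factor
    in q. After the sums over \<open>X\<close> are moved outside, the sums over \<open>P\<close>
    form \<open>D\<close> times its conjugate.\<close>
  have "complex_of_real (\<Sum>p\<in>P. \<Sum>q\<in>P. (norm (A (p - q)))\<^sup>2)
      = (\<Sum>p\<in>P. \<Sum>q\<in>P. \<Sum>x\<in>X. \<Sum>y\<in>X. a x * cnj (a y) *
          (cis (2 * pi * ((g x - g y) \<bullet> p)) * cnj (cis (2 * pi * ((g x - g y) \<bullet> q)))))"
  proof -
    have "complex_of_real ((norm (A (p - q)))\<^sup>2) = (\<Sum>x\<in>X. \<Sum>y\<in>X. a x * cnj (a y) *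
          (cis (2 * pi * ((g x - g y) \<bullet> p)) * cnj (cis (2 * pi * ((g x - g y) \<bullet> q)))))" for p q
    proof -
      have "complex_of_real ((norm (A (p - q)))\<^sup>2) = A (p - q) * cnj (A (p - q))"
        by (rule complex_norm_square)
      also have "\<dots> = (\<Sum>x\<in>X. \<Sum>y\<in>X. (a x * cis (2 * pi * (g x \<bullet> (p - q)))) * cnj (a y * cis (2 * pi * (g y \<bullet> (p - q)))))"
        by (simp add: A_def sum_product)
      also have "\<dots> = (\<Sum>x\<in>X. \<Sum>y\<in>X. a x * cnj (a y) *
          (cis (2 * pi * ((g x - g y) \<bullet> p)) * cnj (cis (2 * pi * ((g x - g y) \<bullet> q)))))"
      proof (intro sum.cong refl)
        fix x y
        let ?c = "cis (2 * pi * (g x \<bullet> (p - q)))" and ?d = "cis (2 * pi * (g y \<bullet> (p - q)))"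
        have "?c * cnj ?d = cis (2 * pi * ((g x - g y) \<bullet> p)) * cnj (cis (2 * pi * ((g x - g y) \<bullet> q)))"
          unfolding cis_cnj cis_mult
          by (rule arg_cong[where f=cis]) (simp add: inner_diff_left inner_diff_right algebra_simps)
        moreover have "(a x * ?c) * cnj (a y * ?d) = a x * cnj (a y) * (?c * cnj ?d)"
          by (simp only: complex_cnj_mult mult_ac)
        ultimately show "(a x * ?c) * cnj (a y * ?d)
            = a x * cnj (a y) * (cis (2 * pi * ((g x - g y) \<bullet> p)) * cnj (cis (2 * pi * ((g x - g y) \<bullet> q))))"
          by (simp only:)
      qed
      finally show ?thesis .
    qed
    then show ?thesis by simp
  qed
  also have "\<dots> = (\<Sum>p\<in>P. \<Sum>x\<in>X. \<Sum>q\<in>P. \<Sum>y\<in>X. a x * cnj (a y) *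
          (cis (2 * pi * ((g x - g y) \<bullet> p)) * cnj (cis (2 * pi * ((g x - g y) \<bullet> q)))))"
    by (rule sum.cong[OF refl], rule sum.swap)
  also have "\<dots> = (\<Sum>x\<in>X. \<Sum>p\<in>P. \<Sum>q\<in>P. \<Sum>y\<in>X. a x * cnj (a y) *
          (cis (2 * pi * ((g x - g y) \<bullet> p)) * cnj (cis (2 * pi * ((g x - g y) \<bullet> q)))))"
    by (rule sum.swap)
  also have "\<dots> = (\<Sum>x\<in>X. \<Sum>p\<in>P. \<Sum>y\<in>X. \<Sum>q\<in>P. a x * cnj (a y) *
          (cis (2 * pi * ((g x - g y) \<bullet> p)) * cnj (cis (2 * pi * ((g x - g y) \<bullet> q)))))"
    by (rule sum.cong[OF refl], rule sum.cong[OF refl], rule sum.swap)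
  also have "\<dots> = (\<Sum>x\<in>X. \<Sum>y\<in>X. \<Sum>p\<in>P. \<Sum>q\<in>P. a x * cnj (a y) *
          (cis (2 * pi * ((g x - g y) \<bullet> p)) * cnj (cis (2 * pi * ((g x - g y) \<bullet> q)))))"
    by (rule sum.cong[OF refl], rule sum.swap)
  also have "\<dots> = (\<Sum>x\<in>X. \<Sum>y\<in>X. a x * cnj (a y) * (D (g x - g y) * cnj (D (g x - g y))))"
  proof -
    have D: "D \<beta> * cnj (D \<beta>) = (\<Sum>p\<in>P. \<Sum>q\<in>P. cis (2 * pi * (\<beta> \<bullet> p)) * cnj (cis (2 * pi * (\<beta> \<bullet> q))))" for \<beta>
      by (simp only: D_def cnj_sum sum_product)
    show ?thesis by (simp only: D sum_distrib_left)
  qed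
  finally have "complex_of_real (\<Sum>p\<in>P. \<Sum>q\<in>P. (norm (A (p - q)))\<^sup>2)
      = (\<Sum>x\<in>X. \<Sum>y\<in>X. a x * cnj (a y) * (D (g x - g y) * cnj (D (g x - g y))))" .
  then have "(\<Sum>p\<in>P. \<Sum>q\<in>P. (norm (A (p - q)))\<^sup>2)
      = norm (\<Sum>x\<in>X. \<Sum>y\<in>X. a x * cnj (a y) * (D (g x - g y) * cnj (D (g x - g y))))"
    by (subst (asm) eq_commute, elim ssubst, subst norm_of_real)
       (rule abs_of_nonneg[symmetric], intro sum_nonneg, rule zero_le_power2)
  also have "\<dots> \<le> (\<Sum>x\<in>X. \<Sum>y\<in>X. norm (a x * cnj (a y) * (D (g x - g y) * cnj (D (g x - g y)))))"
    by (intro order.trans[OF norm_sum] sum_mono order_refl)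
  also have "\<dots> \<le> (\<Sum>x\<in>X. \<Sum>y\<in>X. (norm (D (g x - g y)))\<^sup>2)"
  proof (intro sum_mono)
    fix x y assume xy: "x \<in> X" "y \<in> X"
    have "norm (a x) * norm (a y) \<le> 1"
      using a[OF xy(1)] a[OF xy(2)] by (intro mult_le_one) auto
    then have "norm (a x) * norm (a y) * (norm (D (g x - g y)))\<^sup>2 \<le> 1 * (norm (D (g x - g y)))\<^sup>2"
      by (intro mult_right_mono) auto
    then show "norm (a x * cnj (a y) * (D (g x - g y) * cnj (D (g x - g y)))) \<le> (norm (D (g x - g y)))\<^sup>2"
      by (simp add: norm_mult power2_eq_square)
  qed
  also have "\<dots> = (\<Sum>y\<in>X. \<Sum>x\<in>X. (norm (D (g x - g y)))\<^sup>2)"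
    by (rule sum.swap)
  also have "\<dots> \<le> (\<Sum>y\<in>X. K * (40 * (real N)\<^sup>2) ^ CARD('n))"
  proof (rule sum_mono)
    fix y assume y: "y \<in> X"
    have "(\<Sum>x\<in>X. (norm (D (g x - g y)))\<^sup>2) = (\<Sum>x\<in>X. \<Prod>j\<in>UNIV. (norm (\<Sum>l\<in>{0..<int N}. cis (2 * pi * ((g x - g y) $ j * of_int l))))\<^sup>2)"
      unfolding D_def P_def by (intro sum.cong refl sum_grid_cis_norm_sq) simp
    also have "\<dots> \<le> K * (40 * (real N)\<^sup>2) ^ CARD('n)"
      using assms(2) K[OF y] by (intro sum_prod_exp_sum_le[OF assms(1)]) auto
    finally show "(\<Sum>x\<in>X. (norm (D (g x - g y)))\<^sup>2) \<le> K * (40 * (real N)\<^sup>2) ^ CARD('n)" .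
  qed
  finally have 2: "(\<Sum>p\<in>P. \<Sum>q\<in>P. (norm (A (p - q)))\<^sup>2) \<le> real (card X) * K * (40 * (real N)\<^sup>2) ^ CARD('n)"
    by (simp add: mult.assoc)
  from order.trans[OF 1 2] show ?thesis by (simp add: A_def B_def)
qed

section \<open>The theta sum and its lattice\<close>

lemma symmetric_matrix_inner:
  assumes "symmetric_matrix Q"
  shows "(Q *v x) \<bullet> y = x \<bullet> (Q *v y)"
  using assms unfolding symmetric_matrix_def by (metis dot_lmul_matrix transpose_matrix_vector)

lemma quad_add:
  assumes "symmetric_matrix Q"
  shows "quad Q (x + y) = quad Q x + quad Q y + 2 * ((Q *v x) \<bullet> y)"
  using symmetric_matrix_inner[OF assms, of y x]
  by (simp add: quad_def matrix_vector_right_distrib inner_add_left inner_add_right inner_commute)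

lemma quad_scaleR: "quad Q (c *\<^sub>R x) = c\<^sup>2 * quad Q x"
  by (simp add: quad_def matrix_vector_mult_scaleR power2_eq_square)

lemma integer_points_diff: "x \<in> integer_points \<Longrightarrow> y \<in> integer_points \<Longrightarrow> x - y \<in> integer_points"
  by (auto simp: integer_points_def)

lemma integer_points_inner: "x \<in> integer_points \<Longrightarrow> y \<in> integer_points \<Longrightarrow> x \<bullet> y \<in> \<int>"
  by (auto simp: integer_points_def inner_vec_def intro!: Ints_sum)

lemma grid_integer_points: "grid L \<subseteq> (integer_points :: (real^'n) set)"
proof
  fix x :: "real^'n" assume "x \<in> grid L"
  then have "x $ i \<in> of_int ` L" for i by (simp add: grid_def)
  moreover have "real_of_int ` L \<subseteq> \<int>" by auto
  ultimately have "x $ i \<in> \<int>" for i by blast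
  then show "x \<in> integer_points" by (simp add: integer_points_def)
qed

lemma grid_symmetric_iff:
  "x \<in> grid {- int m..int m} \<longleftrightarrow> x \<in> integer_points \<and> (\<forall>i. \<bar>x $ i\<bar> \<le> real m)"
proof
  assume *: "x \<in> integer_points \<and> (\<forall>i. \<bar>x $ i\<bar> \<le> real m)"
  show "x \<in> grid {- int m..int m}"
    unfolding grid_def
  proof (rule CollectI, rule allI)
    fix i
    obtain l where l: "x $ i = of_int l" using * by (auto simp: integer_points_def elim!: Ints_cases)
    moreover have "\<bar>x $ i\<bar> \<le> real m" using * by blast
    ultimately have "l \<in> {- int m..int m}" by (simp add: abs_le_iff)
    then show "x $ i \<in> of_int ` {- int m..int m}" using l by blast
  qed
next
  assume *: "x \<in> grid {- int m..int m}"
  have "\<bar>x $ i\<bar> \<le> real m" for i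
  proof -
    obtain l where "x $ i = of_int l" "l \<in> {- int m..int m}" using * unfolding grid_def by blast
    then show ?thesis by (simp add: abs_le_iff)
  qed
  then show "x \<in> integer_points \<and> (\<forall>i. \<bar>x $ i\<bar> \<le> real m)"
    using * grid_integer_points by blast
qed

text \<open>Writing a point as x + y makes the phase bilinear in two independent variables. The
  range of x is doubled so that an integer point z with |z| <= R in the maximum norm is reached from
  every y of the smaller cube, namely with x = z - y.\<close>

definition theta :: "real^'n^'n \<Rightarrow> real^'n \<Rightarrow> nat \<Rightarrow> real \<Rightarrow> complex" where
  "theta Q M R s = (\<Sum>x\<in>grid {- int (2 * R)..int (2 * R)}. \<Sum>y\<in>grid {- int R..int R}.
      cis (pi * s * quad Q (x + y - M)))"

text \<open>Subtracting a fixed \<open>x0\<close> of the cell removes the shift \<open>z\<close>.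
  Two points with the same rounded positions \<open>c\<close> differ by at most 1 in each coordinate
  of N times the residue, so their difference is one of the pairs counted by
  \<open>K\<close>.\<close>

lemma card_cell_le:
  fixes Q :: "real^'n^'n"
  assumes "N > 0"
    and K: "\<And>F. finite F \<Longrightarrow>
      (\<And>h k. (h, k) \<in> F \<Longrightarrow> h \<in> integer_points \<and> k \<in> integer_points \<and> (\<forall>i. \<bar>h $ i\<bar> \<le> 4 * real R) \<and>
        (\<forall>i. \<bar>(s *\<^sub>R (Q *v h) - k) $ i\<bar> \<le> 1 / real N)) \<Longrightarrow> real (card F) \<le> K"
  shows "real (card {x \<in> grid {- int (2 * R)..int (2 * R)}.
      \<forall>j. round (real N * ((s *\<^sub>R (Q *v x) - z) $ j - of_int (round ((s *\<^sub>R (Q *v x) - z) $ j)))) = c j}) \<le> K"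
    (is "real (card ?C) \<le> K")
proof (cases "?C = {}")
  case True
  then show ?thesis using K[of "{}"] by (simp only: True) simp
next
  case False
  then obtain x0 where x0: "x0 \<in> ?C" by blast
  define k where "k = (\<lambda>x. \<chi> j. real_of_int (round ((s *\<^sub>R (Q *v x) - z) $ j)))"
  define f where "f = (\<lambda>x. (x - x0, k x - k x0))"
  have kZ: "k x \<in> integer_points" for x by (simp add: k_def integer_points_def)
  have "real (card (f ` ?C)) \<le> K"
  proof (rule K)
    show "finite (f ` ?C)" by (intro finite_imageI finite_Collect_conjI) (auto simp: finite_grid)
  next
    fix h k' assume "(h, k') \<in> f ` ?C"
    then obtain x where x: "x \<in> ?C" "h = x - x0" "k' = k x - k x0" by (auto simp: f_def)
    have xb: "x \<in> integer_points" "x0 \<in> integer_points"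
      "\<And>i. \<bar>x $ i\<bar> \<le> 2 * real R" "\<And>i. \<bar>x0 $ i\<bar> \<le> 2 * real R"
      using x(1) x0 unfolding mem_Collect_eq grid_symmetric_iff by auto
    have "\<bar>h $ i\<bar> \<le> 4 * real R" for i
      using xb(3)[of i] xb(4)[of i] x(2) by simp
    moreover have "\<bar>(s *\<^sub>R (Q *v h) - k') $ i\<bar> \<le> 1 / real N" for i
    proof -
      define e where "e = (\<lambda>x. real N * ((s *\<^sub>R (Q *v x) - z) $ i - k x $ i))"
      have e: "\<bar>e y - of_int (c i)\<bar> \<le> 1/2" if "y \<in> ?C" for y
        using of_int_round_abs_le[of "e y"] that by (simp add: e_def k_def abs_minus_commute)
      have "\<bar>e x - e x0\<bar> \<le> 1" using e[OF x(1)] e[OF x0] by linarith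
      moreover have "e x - e x0 = real N * (s *\<^sub>R (Q *v h) - k') $ i"
        by (simp add: e_def x(2,3) matrix_vector_mult_diff_distrib algebra_simps)
      ultimately have "\<bar>(s *\<^sub>R (Q *v h) - k') $ i\<bar> * real N \<le> 1"
        by (simp only: abs_mult abs_of_nat mult.commute)
      then show ?thesis using assms(1) by (subst pos_le_divide_eq) auto
    qed
    ultimately show "h \<in> integer_points \<and> k' \<in> integer_points \<and> (\<forall>i. \<bar>h $ i\<bar> \<le> 4 * real R) \<and>
        (\<forall>i. \<bar>(s *\<^sub>R (Q *v h) - k') $ i\<bar> \<le> 1 / real N)"
      using x xb kZ by (auto intro!: integer_points_diff)
  qed
  moreover have "card (f ` ?C) = card ?C"
    by (rule card_image) (auto simp: f_def inj_on_def)
  ultimately show ?thesis by simp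
qed

text \<open>Up to the factors \<open>u y\<close> and \<open>a x\<close> of modulus 1, the summand is
  a character in \<open>y\<close> with frequency \<open>g x\<close>. Cauchy-Schwarz in
  \<open>y\<close> discards \<open>u\<close>, and the large sieve handles the rest. The factor 16 d
  in \<open>N\<close> is what later makes the symplectic form smaller than 1 in
  \<open>card_isotropic_le\<close>.\<close>

lemma theta_norm_sq_le:
  fixes Q :: "real^'n^'n"
  assumes "symmetric_matrix Q" "R > 0" and N: "N = 16 * CARD('n) * R"
    and K: "\<And>F. finite F \<Longrightarrow>
      (\<And>h k. (h, k) \<in> F \<Longrightarrow> h \<in> integer_points \<and> k \<in> integer_points \<and> (\<forall>i. \<bar>h $ i\<bar> \<le> 4 * real R) \<and>
        (\<forall>i. \<bar>(s *\<^sub>R (Q *v h) - k) $ i\<bar> \<le> 1 / real N)) \<Longrightarrow> real (card F) \<le> K"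
  shows "(norm (theta Q M R s))\<^sup>2 \<le> (19200 * real CARD('n) * real R ^ 3) ^ CARD('n) * K"
proof -
  let ?d = "CARD('n)"
  define X :: "(real^'n) set" where "X = grid {- int (2 * R)..int (2 * R)}"
  define B :: "(real^'n) set" where "B = grid {- int R..int R}"
  define g where "g = (\<lambda>x. s *\<^sub>R (Q *v x))"
  define a where "a = (\<lambda>x. cis (pi * s * quad Q (x - M)))"
  define u where "u = (\<lambda>y. cis (pi * s * (quad Q y - 2 * ((Q *v M) \<bullet> y))))"
  define A where "A = (\<lambda>y. \<Sum>x\<in>X. a x * cis (2 * pi * (g x \<bullet> y)))"
  have fin: "finite X" "finite B" by (auto simp: X_def B_def finite_grid)
  have K0: "K \<ge> 0" using K[of "{}"] by simp
  have d: "?d \<ge> 1" by (simp add: Suc_leI)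
  have NR: "16 * R \<le> N" using d by (simp add: N)
  have "theta Q M R s = (\<Sum>x\<in>X. \<Sum>y\<in>B. u y * (a x * cis (2 * pi * (g x \<bullet> y))))"
  proof -
    have "cis (pi * s * quad Q (x + y - M)) = u y * (a x * cis (2 * pi * (g x \<bullet> y)))" for x y
    proof -
      have "quad Q (x + y - M) = quad Q (x - M) + quad Q y + 2 * ((Q *v x) \<bullet> y - (Q *v M) \<bullet> y)"
        using quad_add[OF assms(1), of "x - M" y]
        by (simp add: algebra_simps matrix_vector_mult_diff_distrib inner_diff_left)
      then have eq: "pi * s * quad Q (x + y - M)
          = pi * s * (quad Q (x - M) + quad Q y + 2 * ((Q *v x) \<bullet> y - (Q *v M) \<bullet> y))"
        by (simp only:)
      show ?thesis
        unfolding u_def a_def g_def cis_mult eq by (intro arg_cong[where f=cis]) (simp add: algebra_simps)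
    qed
    then show ?thesis by (simp add: theta_def X_def B_def)
  qed
  also have "\<dots> = (\<Sum>y\<in>B. u y * A y)"
    by (subst sum.swap) (simp add: A_def sum_distrib_left)
  finally have "norm (theta Q M R s) \<le> (\<Sum>y\<in>B. norm (u y * A y))"
    by (simp only: norm_sum)
  also have "\<dots> = (\<Sum>y\<in>B. 1 * norm (A y))" by (simp add: norm_mult u_def)
  finally have "(norm (theta Q M R s))\<^sup>2 \<le> (\<Sum>y\<in>B. 1 * norm (A y))\<^sup>2"
    by (intro power_mono) auto
  also have "\<dots> \<le> (\<Sum>y\<in>B. 1\<^sup>2) * (\<Sum>y\<in>B. (norm (A y))\<^sup>2)"
    by (rule Cauchy_Schwarz_ineq_sum)
  also have "\<dots> = real (2 * R + 1) ^ ?d * (\<Sum>y\<in>B. (norm (A y))\<^sup>2)"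
    by (simp add: B_def card_grid nat_add_distrib nat_mult_distrib add_ac)
  finally have 1: "(norm (theta Q M R s))\<^sup>2 \<le> real (2 * R + 1) ^ ?d * (\<Sum>y\<in>B. (norm (A y))\<^sup>2)" .
  have "(real N - 2 * real R) ^ ?d * (\<Sum>y\<in>B. (norm (A y))\<^sup>2) \<le> real (card X) * K * (40 * (real N)\<^sup>2) ^ ?d"
    unfolding A_def B_def
  proof (rule large_sieve_grid)
    show "2 * R < N" using NR assms(2) by linarith
    show "real (card {x \<in> X. \<forall>j. round (real N * ((g x - g y) $ j - of_int (round ((g x - g y) $ j)))) = c j}) \<le> K"
      if "y \<in> X" for y c
      unfolding X_def g_def
      using NR assms(2) by (intro card_cell_le K) auto
  qed (auto simp: fin a_def)
  \<comment> \<open>Since N >= 16 R, the shrunken cube keeps at least half of its side. The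
    resulting factor N/2 is cancelled below against one split off from 40 N^2.\<close>
  moreover have "(real N / 2) ^ ?d \<le> (real N - 2 * real R) ^ ?d"
    using NR by (intro power_mono) auto
  ultimately have "(real N / 2) ^ ?d * (\<Sum>y\<in>B. (norm (A y))\<^sup>2) \<le> real (card X) * K * (40 * (real N)\<^sup>2) ^ ?d"
    by (meson mult_right_mono order_trans sum_nonneg zero_le_power2)
  also have "\<dots> = (real N / 2) ^ ?d * (real (4 * R + 1) ^ ?d * K * (80 * real N) ^ ?d)"
  proof -
    have "(40 * (real N)\<^sup>2) ^ ?d = (real N / 2) ^ ?d * (80 * real N) ^ ?d"
      by (subst power_mult_distrib[symmetric]) (simp add: power2_eq_square)
    moreover have "card X = (4 * R + 1) ^ ?d"
      by (simp add: X_def card_grid nat_add_distrib nat_mult_distrib)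
    ultimately show ?thesis by simp
  qed
  finally have "(\<Sum>y\<in>B. (norm (A y))\<^sup>2) \<le> real (4 * R + 1) ^ ?d * K * (80 * real N) ^ ?d"
    using NR assms(2) by (subst (asm) mult_le_cancel_left_pos) auto
  then have "real (2 * R + 1) ^ ?d * (\<Sum>y\<in>B. (norm (A y))\<^sup>2)
      \<le> real (2 * R + 1) ^ ?d * (real (4 * R + 1) ^ ?d * K * (80 * real N) ^ ?d)"
    by (rule mult_left_mono) simp
  also have "\<dots> = (real (2 * R + 1) * real (4 * R + 1) * (80 * real N)) ^ ?d * K"
    by (simp only: power_mult_distrib mult_ac)
  also have "\<dots> \<le> (3 * real R * (5 * real R) * (80 * real N)) ^ ?d * K"
    using assms(2) by (intro mult_right_mono power_mono mult_mono K0) auto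
  also have "3 * real R * (5 * real R) * (80 * real N) = 19200 * real ?d * real R ^ 3"
    by (simp add: N power3_eq_cube)
  finally show ?thesis using 1 by linarith
qed

text \<open>In the coordinates (h/R, R(sQh - k)) the difference of two distinct elements of
  \<open>F\<close> is a nonzero lattice vector, so by \<open>sep\<close> it has length at least
  \<open>\<mu>\<close>. The image of \<open>F\<close> is isotropic and has radius at most 5d, and
  the packing bound applies; \<open>\<mu> \<le> 1\<close> gives the constant 11.\<close>

lemma card_isotropic_le:
  fixes Q :: "real^'n^'n"
  assumes "symmetric_matrix Q" "R > 0" "0 < \<mu>" "\<mu> \<le> 1" "finite F"
    and F: "\<And>h k. (h, k) \<in> F \<Longrightarrow> h \<in> integer_points \<and> k \<in> integer_points \<and> (\<forall>i. \<bar>h $ i\<bar> \<le> 4 * real R) \<and>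
        (\<forall>i. \<bar>(s *\<^sub>R (Q *v h) - k) $ i\<bar> \<le> 1 / real (16 * CARD('n) * R))"
    and sep: "\<And>h k. h \<in> integer_points \<Longrightarrow> k \<in> integer_points \<Longrightarrow> (h, k) \<noteq> 0 \<Longrightarrow>
       \<mu> * real R \<le> norm h \<or> \<mu> \<le> real R * norm (s *\<^sub>R (Q *v h) - k)"
  shows "real (card F) \<le> (11 * real CARD('n) / \<mu>) ^ CARD('n)"
proof -
  let ?d = "real CARD('n)"
  define e where "e = (\<lambda>h k. s *\<^sub>R (Q *v h) - k)"
  define f where "f = (\<lambda>(h, k). ((1 / real R) *\<^sub>R h, real R *\<^sub>R e h k))"
  have d: "?d \<ge> 1" by (simp add: Suc_leI)
  have R: "real R > 0" using assms(2) by simp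
  have e_diff: "e h k - e h' k' = e (h - h') (k - k')" for h k h' k'
    by (simp add: e_def matrix_vector_mult_diff_distrib algebra_simps)
  have big: "\<mu> \<le> norm (f x - f y)" if "x \<in> F" "y \<in> F" "x \<noteq> y" for x y
  proof -
    obtain h k h' k' where xy: "x = (h, k)" "y = (h', k')" by (metis surj_pair)
    have fd: "f x - f y = ((1 / real R) *\<^sub>R (h - h'), real R *\<^sub>R e (h - h') (k - k'))"
      by (simp add: xy f_def e_diff[symmetric] scaleR_diff_right)
    have "\<mu> * real R \<le> norm (h - h') \<or> \<mu> \<le> real R * norm (e (h - h') (k - k'))"
      using F that xy unfolding e_def by (intro sep integer_points_diff) (auto simp: zero_prod_def)
    moreover have "norm (h - h') / real R \<le> norm (f x - f y)"
      unfolding fd using R norm_fst_le[of "(1 / real R) *\<^sub>R (h - h')"] by simp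
    moreover have "real R * norm (e (h - h') (k - k')) \<le> norm (f x - f y)"
      unfolding fd using R norm_snd_le[of "real R *\<^sub>R e (h - h') (k - k')"] by simp
    moreover have "\<mu> * real R \<le> norm (h - h') \<Longrightarrow> \<mu> \<le> norm (h - h') / real R"
      using R by (simp add: pos_le_divide_eq)
    ultimately show ?thesis by linarith
  qed
  have inj: "inj_on f F"
    using big assms(3) by (intro inj_onI) force
  have bound: "norm h \<le> 4 * ?d * real R" "norm (e h k) \<le> 1 / (16 * real R)" if "(h, k) \<in> F" for h k
  proof -
    have "norm h \<le> (\<Sum>i\<in>UNIV. \<bar>h $ i\<bar>)" by (rule norm_le_l1_cart)
    also have "\<dots> \<le> (\<Sum>i\<in>(UNIV::'n set). 4 * real R)" using F[OF that] by (intro sum_mono) auto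
    finally show "norm h \<le> 4 * ?d * real R" by simp
    have "norm (e h k) \<le> (\<Sum>i\<in>UNIV. \<bar>e h k $ i\<bar>)" by (rule norm_le_l1_cart)
    also have "\<dots> \<le> (\<Sum>i\<in>(UNIV::'n set). 1 / real (16 * CARD('n) * R))"
      using F[OF that] unfolding e_def by (intro sum_mono) auto
    also have "\<dots> = 1 / (16 * real R)" by simp
    finally show "norm (e h k) \<le> 1 / (16 * real R)" .
  qed
  have inner_small: "\<bar>h \<bullet> e h' k'\<bar> \<le> 1/4" if "(h, k) \<in> F" "(h', k') \<in> F" for h k h' k'
  proof -
    have "\<bar>h \<bullet> e h' k'\<bar> \<le> (\<Sum>i\<in>UNIV. \<bar>h $ i * e h' k' $ i\<bar>)"
      unfolding inner_vec_def by (simp add: sum_abs)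
    also have "\<dots> \<le> (\<Sum>i\<in>(UNIV::'n set). 4 * real R * (1 / real (16 * CARD('n) * R)))"
      unfolding abs_mult using F[OF that(1)] F[OF that(2)] unfolding e_def
      by (intro sum_mono mult_mono) auto
    also have "\<dots> = 1/4" using R by simp
    finally show ?thesis .
  qed
  have "real (card (f ` F)) \<le> ((2 * (5 * ?d) + \<mu>) / \<mu>) ^ CARD('n)"
  proof (rule separated_isotropic_card_le)
    fix v assume "v \<in> f ` F"
    then obtain h k where hk: "(h, k) \<in> F" "v = ((1 / real R) *\<^sub>R h, real R *\<^sub>R e h k)"
      by (auto simp: f_def)
    have "norm v \<le> norm ((1 / real R) *\<^sub>R h) + norm (real R *\<^sub>R e h k)"
      unfolding hk(2) by (rule norm_Pair_le)
    also have "norm ((1 / real R) *\<^sub>R h) \<le> 4 * ?d"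
      using bound(1)[OF hk(1)] R by (simp add: pos_divide_le_eq)
    also have "norm (real R *\<^sub>R e h k) \<le> 1"
    proof -
      have "real R * norm (e h k) \<le> real R * (1 / (16 * real R))"
        using bound(2)[OF hk(1)] R by (intro mult_left_mono) auto
      also have "\<dots> \<le> 1" using R by simp
      finally show ?thesis by simp
    qed
    finally show "norm v \<le> 5 * ?d" using d by linarith
  next
    fix x y assume "x \<in> f ` F" "y \<in> f ` F" "x \<noteq> y"
    then show "\<mu> \<le> norm (x - y)" using big by blast
  next
    fix v w assume "v \<in> f ` F" "w \<in> f ` F"
    then obtain h k h' k' where hk: "(h, k) \<in> F" "v = ((1 / real R) *\<^sub>R h, real R *\<^sub>R e h k)"
      "(h', k') \<in> F" "w = ((1 / real R) *\<^sub>R h', real R *\<^sub>R e h' k')"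
      by (auto simp: f_def)
    \<comment> \<open>By symmetry of \<open>Q\<close> the two terms containing \<open>s\<close>
      cancel and only integer inner products remain. Both terms on the left are at most 1/4 in
      absolute value, so this integer is 0.\<close>
    have eq: "h \<bullet> e h' k' - h' \<bullet> e h k = h' \<bullet> k - h \<bullet> k'"
      using symmetric_matrix_inner[OF assms(1), of h h'] 
      by (simp add: e_def inner_diff_right inner_commute)
    have "h' \<bullet> k - h \<bullet> k' \<in> \<int>"
      using F[OF hk(1)] F[OF hk(3)] by (intro Ints_diff integer_points_inner) auto
    moreover have "\<bar>h' \<bullet> k - h \<bullet> k'\<bar> < 1"
      using inner_small[OF hk(1,3)] inner_small[OF hk(3,1)] eq by linarith
    ultimately have "h' \<bullet> k - h \<bullet> k' = 0"
      using Ints_nonzero_abs_less1 by blast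
    then show "fst v \<bullet> snd w = snd v \<bullet> fst w"
      using eq R by (simp add: hk inner_commute)
  qed (use assms d in auto)
  also have "\<dots> \<le> (11 * ?d / \<mu>) ^ CARD('n)"
  proof (intro power_mono divide_right_mono)
    show "2 * (5 * ?d) + \<mu> \<le> 11 * ?d" using assms(4) d by linarith
  qed (use assms(3) in auto)
  finally show ?thesis using card_image[OF inj] by simp
qed

section \<open>Resonant parameters\<close>

definition block_vector :: "'n set \<Rightarrow> real^'n \<Rightarrow> bool" where
  "block_vector S u \<longleftrightarrow> (\<forall>i. i \<notin> S \<longrightarrow> u $ i = 0) \<or> (\<forall>i\<in>S. u $ i = 0)"

lemma matrix_vector_bound:
  fixes Q :: "real^'n^'n"
  obtains B where "B > 0" "\<And>x. norm (Q *v x) \<le> B * norm x"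
  using bounded_linear.pos_bounded[OF matrix_vector_mul_bounded_linear[of Q]]
  by (metis mult.commute)

text \<open>On the compact set of unit vectors lying in one block, |Q[u]| has a positive minimum,
  and by continuity the bilinear form stays away from 0 on pairs of nearby unit vectors.
  \<open>col\<close> names a small ball that contains the direction of \<open>u\<close>. Only
  absolute values occur, so the two blocks may carry opposite signs.\<close>

lemma definite_cone_cover:
  fixes Q :: "real^'n^'n"
  assumes definite: "\<And>u. u \<noteq> 0 \<Longrightarrow> block_vector S u \<Longrightarrow> quad Q u \<noteq> 0"
  obtains c T and col :: "real^'n \<Rightarrow> real^'n"
  where "c > 0" "finite T" "\<And>u. u \<noteq> 0 \<Longrightarrow> block_vector S u \<Longrightarrow> col u \<in> T"
    "\<And>u v. u \<noteq> 0 \<Longrightarrow> v \<noteq> 0 \<Longrightarrow> block_vector S u \<Longrightarrow> block_vector S v \<Longrightarrow> col u = col v \<Longrightarrow>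
      c * norm u * norm v \<le> \<bar>(Q *v u) \<bullet> v\<bar>"
proof -
  define V where "V = sphere 0 1 \<inter> {u. block_vector S u}"
  have "{u. block_vector S u} = (\<Inter>i\<in>-S. {u. u $ i = 0}) \<union> (\<Inter>i\<in>S. {u. u $ i = 0})"
    by (auto simp: block_vector_def)
  moreover have "closed \<dots>"
    by (intro closed_Un closed_INT ballI closed_Collect_eq continuous_intros)
  ultimately have cV: "compact V"
    unfolding V_def by (intro compact_Int_closed compact_sphere) simp
  \<comment> \<open>Any index will do: its axis vector lies in one of the two blocks, so
    \<open>V\<close> is nonempty and the minimum is attained.\<close>
  obtain i0 :: 'n where True by simp
  have "axis i0 1 \<in> V"
    by (auto simp: V_def block_vector_def axis_def norm_axis_1[unfolded axis_def])
  then have V0: "V \<noteq> {}" by blast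
  have "continuous_on V (\<lambda>u. \<bar>quad Q u\<bar>)"
    unfolding quad_def by (intro continuous_intros matrix_vector_mult_linear_continuous_on)
  then obtain u0 where u0: "u0 \<in> V" "\<And>u. u \<in> V \<Longrightarrow> \<bar>quad Q u0\<bar> \<le> \<bar>quad Q u\<bar>"
    using continuous_attains_inf[OF cV V0] by blast
  define c0 where "c0 = \<bar>quad Q u0\<bar>"
  have "u0 \<noteq> 0" using u0(1) by (auto simp: V_def)
  then have c0: "c0 > 0" using u0(1) definite by (auto simp: c0_def V_def)
  obtain B where B: "B > 0" "\<And>x. norm (Q *v x) \<le> B * norm x"
    using matrix_vector_bound by metis
  \<comment> \<open>Unit vectors in the same ball are closer than \<open>2 * \<epsilon>\<close>,
    which changes the form by at most 2 B \<open>\<epsilon>\<close> = c0/2, half of the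
    minimum.\<close>
  define \<epsilon> where "\<epsilon> = c0 / (4 * B)"
  have "\<epsilon> > 0" using B c0 by (simp add: \<epsilon>_def)
  then obtain T where T: "finite T" "V \<subseteq> (\<Union>t\<in>T. ball t \<epsilon>)"
    using cV unfolding compact_eq_totally_bounded by metis
  define col where "col = (\<lambda>u::real^'n. SOME t. t \<in> T \<and> dist t (u /\<^sub>R norm u) < \<epsilon>)"
  have unit: "u /\<^sub>R norm u \<in> V" if "u \<noteq> 0" "block_vector S u" for u
    using that by (auto simp: V_def block_vector_def)
  have col: "col u \<in> T \<and> dist (col u) (u /\<^sub>R norm u) < \<epsilon>" if u: "u \<noteq> 0" "block_vector S u" for u
  proof -
    have "\<exists>t. t \<in> T \<and> dist t (u /\<^sub>R norm u) < \<epsilon>"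
    proof -
      obtain t where "t \<in> T" "u /\<^sub>R norm u \<in> ball t \<epsilon>" using unit[OF u] T(2) by blast
      then show ?thesis unfolding mem_ball by blast
    qed
    then show ?thesis unfolding col_def by (rule someI_ex)
  qed
  show thesis
  proof (rule that[of "c0/2" T col])
    fix u v :: "real^'n"
    assume uv: "u \<noteq> 0" "v \<noteq> 0" "block_vector S u" "block_vector S v" "col u = col v"
    let ?u = "u /\<^sub>R norm u" and ?v = "v /\<^sub>R norm v"
    have "dist ?u ?v < 2 * \<epsilon>"
      using col[OF uv(1,3)] col[OF uv(2,4)] uv(5) dist_triangle3[of ?u ?v "col u"]
      by (simp add: dist_commute)
    then have close: "norm (?v - ?u) \<le> 2 * \<epsilon>" by (simp add: dist_norm norm_minus_commute)
    have "\<bar>(Q *v ?u) \<bullet> (?v - ?u)\<bar> \<le> norm (Q *v ?u) * norm (?v - ?u)"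
      by (rule Cauchy_Schwarz_ineq2)
    also have "\<dots> \<le> B * (2 * \<epsilon>)"
      using B(2)[of ?u] close B(1) uv(1) by (intro mult_mono) auto
    also have "\<dots> = c0 / 2" using B(1) by (simp add: \<epsilon>_def)
    finally have "\<bar>(Q *v ?u) \<bullet> (?v - ?u)\<bar> \<le> c0 / 2" .
    moreover have "c0 \<le> \<bar>(Q *v ?u) \<bullet> ?u\<bar>"
      using u0(2)[OF unit[OF uv(1,3)]] by (simp add: c0_def quad_def)
    moreover have "(Q *v ?u) \<bullet> ?v = (Q *v ?u) \<bullet> ?u + (Q *v ?u) \<bullet> (?v - ?u)"
      by (simp add: inner_diff_right)
    ultimately have "c0 / 2 \<le> \<bar>(Q *v ?u) \<bullet> ?v\<bar>" by linarith
    also have "\<dots> = \<bar>(Q *v u) \<bullet> v\<bar> / (norm u * norm v)"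
      by (simp add: matrix_vector_mult_scaleR abs_mult divide_inverse)
    finally show "c0 / 2 * norm u * norm v \<le> \<bar>(Q *v u) \<bullet> v\<bar>"
      using uv(1,2) by (simp add: pos_le_divide_eq mult.assoc)
  qed (use c0 T col in auto)
qed

section \<open>Clusters of integers\<close>

lemma card_int_diam_le:
  fixes E :: "int set"
  assumes "finite E" "D \<ge> 0" and D: "\<And>i j. i \<in> E \<Longrightarrow> j \<in> E \<Longrightarrow> \<bar>real_of_int (i - j)\<bar> \<le> D"
  shows "real (card E) \<le> D + 1"
proof (cases "E = {}")
  case False
  define m where "m = Min E"
  have m: "m \<in> E" "\<And>j. j \<in> E \<Longrightarrow> m \<le> j" using assms(1) False by (auto simp: m_def)
  have "E \<subseteq> {m..m + \<lfloor>D\<rfloor>}"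
  proof
    fix j assume j: "j \<in> E"
    have "real_of_int (j - m) \<le> D" using D[OF j m(1)] by linarith
    then have "j - m \<le> \<lfloor>D\<rfloor>" by (simp add: le_floor_iff)
    then show "j \<in> {m..m + \<lfloor>D\<rfloor>}" using m(2)[OF j] by auto
  qed
  then have "card E \<le> card {m..m + \<lfloor>D\<rfloor>}" by (intro card_mono) auto
  also have "\<dots> = nat (\<lfloor>D\<rfloor> + 1)" by simp
  finally have "real (card E) \<le> real (nat (\<lfloor>D\<rfloor> + 1))" by simp
  also have "\<dots> = real_of_int \<lfloor>D\<rfloor> + 1" using assms(2) by simp
  also have "\<dots> \<le> D + 1" by simp
  finally show ?thesis .
qed (use assms in simp)

text \<open>Cutting the interval into windows of length \<open>w\<close> leaves at most 2J/w + 2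
  nonempty ones. By \<open>clust\<close> the points inside one window have diameter at most
  \<open>D\<close>.\<close>

lemma card_int_clusters_le:
  fixes E :: "int set"
  assumes E: "E \<subseteq> {- int J<..<int J}" and "w > 0" "D \<ge> 0"
    and clust: "\<And>i j. i \<in> E \<Longrightarrow> j \<in> E \<Longrightarrow> \<bar>real_of_int (i - j)\<bar> \<le> w \<Longrightarrow> \<bar>real_of_int (i - j)\<bar> \<le> D"
  shows "real (card E) \<le> (2 * real J / w + 2) * (D + 1)"
proof -
  define f where "f = (\<lambda>j::int. \<lfloor>real_of_int j / w\<rfloor>)"
  have fin: "finite E" using E finite_subset by blast
  have fib: "real (card {j \<in> E. f j = c}) \<le> D + 1" for c
  proof (rule card_int_diam_le)
    fix i j assume ij: "i \<in> {j \<in> E. f j = c}" "j \<in> {j \<in> E. f j = c}"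
    have "\<bar>real_of_int i / w - real_of_int j / w\<bar> \<le> 1"
      using ij unfolding f_def by (simp add: floor_eq_iff) linarith
    then have "\<bar>real_of_int (i - j)\<bar> \<le> w"
      using assms(2) by (simp add: diff_divide_distrib[symmetric] field_simps)
    then show "\<bar>real_of_int (i - j)\<bar> \<le> D" using clust ij by blast
  qed (use fin assms in auto)
  have "f ` E \<subseteq> {\<lfloor>- real J / w\<rfloor>..\<lfloor>real J / w\<rfloor>}"
  proof
    fix c assume "c \<in> f ` E"
    then obtain j where j: "j \<in> E" "c = f j" by blast
    then have "- real J \<le> real_of_int j" "real_of_int j \<le> real J" using E by force+
    then have "- real J / w \<le> real_of_int j / w" "real_of_int j / w \<le> real J / w"
      using assms(2) by (intro divide_right_mono; simp)+
    then show "c \<in> {\<lfloor>- real J / w\<rfloor>..\<lfloor>real J / w\<rfloor>}" by (auto simp: j f_def intro!: floor_mono)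
  qed
  then have "card (f ` E) \<le> card {\<lfloor>- real J / w\<rfloor>..\<lfloor>real J / w\<rfloor>}" by (intro card_mono) auto
  then have "real (card (f ` E)) \<le> real (nat (\<lfloor>real J / w\<rfloor> - \<lfloor>- real J / w\<rfloor> + 1))" by simp
  also have "\<dots> = real_of_int (\<lfloor>real J / w\<rfloor> - \<lfloor>- real J / w\<rfloor> + 1)"
  proof -
    have "- real J / w \<le> real J / w" using assms(2) by (intro divide_right_mono) auto
    then have "\<lfloor>- real J / w\<rfloor> \<le> \<lfloor>real J / w\<rfloor>" by (rule floor_mono)
    then show ?thesis by simp
  qed
  also have "\<dots> \<le> 2 * real J / w + 2"
  proof -
    have "real_of_int \<lfloor>real J / w\<rfloor> \<le> real J / w" by simp
    moreover have "- real J / w - 1 < real_of_int \<lfloor>- real J / w\<rfloor>" by linarith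
    moreover have "- real J / w = - (real J / w)" "2 * real J / w = 2 * (real J / w)" by simp_all
    ultimately show ?thesis unfolding of_int_add of_int_diff of_int_1 by linarith
  qed
  finally have im: "real (card (f ` E)) \<le> 2 * real J / w + 2" .
  have "real (card E) = (\<Sum>j\<in>E. 1)" by simp
  also have "\<dots> = (\<Sum>c\<in>f ` E. \<Sum>j\<in>{j \<in> E. f j = c}. 1)" by (rule sum.image_gen[OF fin])
  also have "\<dots> \<le> (\<Sum>c\<in>f ` E. D + 1)" using fib by (intro sum_mono) simp
  also have "\<dots> = real (card (f ` E)) * (D + 1)" by simp
  also have "\<dots> \<le> (2 * real J / w + 2) * (D + 1)"
    using im assms(3) by (intro mult_right_mono) auto
  finally show ?thesis .
qed

text \<open>Two resonant frequencies give an integer close to (s i - s j) times the form at (h i, h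
  j). For frequencies in a common window it vanishes, and the lower bound \<open>cone\<close> then
  forces them much closer together. There are about H^2 windows with about \<open>\<mu>\<close> R/H
  indices in each.\<close>

lemma card_near_resonances_le:
  fixes Q :: "real^'n^'n" and h :: "int \<Rightarrow> real^'n"
  assumes sym: "symmetric_matrix Q" and B: "B > 0" "\<And>x. norm (Q *v x) \<le> B * norm x"
    and pos: "c > 0" "\<sigma> > 0" "R > 0" "\<mu> > 0" "\<mu> \<le> 1/4" "H \<ge> 1" "H \<le> \<mu> * real R"
    and E: "E \<subseteq> {- int (R\<^sup>2)<..<int (R\<^sup>2)}"
    and hk: "\<And>j. j \<in> E \<Longrightarrow> h j \<in> integer_points \<and> k j \<in> integer_points \<and> H \<le> norm (h j) \<and> norm (h j) \<le> 2 * H \<and>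
      norm ((\<sigma> * of_int j / (real R)\<^sup>2) *\<^sub>R (Q *v h j) - k j) \<le> \<mu> / real R"
    and cone: "\<And>i j. i \<in> E \<Longrightarrow> j \<in> E \<Longrightarrow> c * norm (h i) * norm (h j) \<le> \<bar>(Q *v h i) \<bullet> h j\<bar>"
  shows "real (card E) \<le> (16 * B * \<sigma> + 2) * (4 / (c * \<sigma>) + 1) * (\<mu> * real R * H)"
proof -
  define s where "s = (\<lambda>j. \<sigma> * of_int j / (real R)\<^sup>2)"
  define e where "e = (\<lambda>j. s j *\<^sub>R (Q *v h j) - k j)"
  \<comment> \<open>The form is at most 4 B H^2 here, so |i - j| <= w makes its product with s i - s
    j at most 1/2. \<open>D\<close> is what remains of |i - j| once the integer is known to be
    0.\<close>
  define w where "w = (real R)\<^sup>2 / (8 * B * \<sigma> * H\<^sup>2)"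
  define D where "D = 4 * \<mu> * real R / (c * \<sigma> * H)"
  have R: "real R > 0" and H: "H > 0" using pos by auto
  have eh: "\<bar>e i \<bullet> h j\<bar> \<le> 2 * \<mu> * H / real R" if "i \<in> E" "j \<in> E" for i j
  proof -
    have "\<bar>e i \<bullet> h j\<bar> \<le> norm (e i) * norm (h j)" by (rule Cauchy_Schwarz_ineq2)
    also have "\<dots> \<le> (\<mu> / real R) * (2 * H)"
      using hk[OF that(1)] hk[OF that(2)] R pos unfolding e_def s_def by (intro mult_mono) auto
    finally show ?thesis by (simp add: mult_ac)
  qed
  have small: "2 * \<mu> * H / real R \<le> 1/8"
  proof -
    have "\<mu> * H \<le> (1/4) * (1/4 * real R)"
    proof (rule mult_mono)
      show "H \<le> 1/4 * real R" using pos(5,7) R mult_right_mono[of \<mu> "1/4" "real R"] by linarith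
    qed (use pos in auto)
    then show ?thesis using R by (simp add: pos_divide_le_eq)
  qed
  have "real (card E) \<le> (2 * real (R\<^sup>2) / w + 2) * (D + 1)"
  proof (rule card_int_clusters_le[OF E])
    show "w > 0" using pos B R by (simp add: w_def)
    show "D \<ge> 0" using pos by (simp add: D_def)
  next
    fix i j assume ij: "i \<in> E" "j \<in> E" and close: "\<bar>real_of_int (i - j)\<bar> \<le> w"
    let ?q = "(Q *v h i) \<bullet> h j"
    have sdiff: "\<bar>s i - s j\<bar> = \<sigma> * \<bar>real_of_int (i - j)\<bar> / (real R)\<^sup>2"
      using pos by (simp add: s_def abs_mult abs_divide flip: diff_divide_distrib right_diff_distrib)
    have int: "k i \<bullet> h j - k j \<bullet> h i \<in> \<int>"
      using hk[OF ij(1)] hk[OF ij(2)] by (intro Ints_diff integer_points_inner) auto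
    \<comment> \<open>Replacing each k by s Q h - e leaves the difference of the frequencies times
      the form, by symmetry of \<open>Q\<close>. The two error terms contribute at most 1/8 each, so
      1/2 + 1/8 + 1/8 < 1.\<close>
    have eq: "k i \<bullet> h j - k j \<bullet> h i = (s i - s j) * ?q - e i \<bullet> h j + e j \<bullet> h i"
    proof -
      have "(Q *v h j) \<bullet> h i = ?q"
        using symmetric_matrix_inner[OF sym, of "h j" "h i"] by (simp add: inner_commute)
      then show ?thesis by (simp add: e_def inner_diff_left algebra_simps)
    qed
    have "\<bar>?q\<bar> \<le> norm (Q *v h i) * norm (h j)" by (rule Cauchy_Schwarz_ineq2)
    also have "\<dots> \<le> (B * (2 * H)) * (2 * H)"
    proof (rule mult_mono)
      show "norm (Q *v h i) \<le> B * (2 * H)"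
        using order.trans[OF B(2)[of "h i"] mult_left_mono[of "norm (h i)" "2 * H" B]] hk[OF ij(1)] B(1) by auto
    qed (use hk[OF ij(2)] B H in auto)
    finally have q: "\<bar>?q\<bar> \<le> 4 * B * H\<^sup>2" by (simp add: power2_eq_square)
    have "\<bar>s i - s j\<bar> \<le> \<sigma> * w / (real R)\<^sup>2"
      unfolding sdiff using close pos by (intro divide_right_mono mult_left_mono) auto
    also have "\<dots> = 1 / (8 * B * H\<^sup>2)"
      using R pos by (simp add: w_def)
    finally have "\<bar>s i - s j\<bar> * \<bar>?q\<bar> \<le> 1 / (8 * B * H\<^sup>2) * (4 * B * H\<^sup>2)"
      using q B H by (intro mult_mono) auto
    also have "\<dots> = 1/2" using B H by simp
    finally have "\<bar>(s i - s j) * ?q\<bar> \<le> 1/2" by (simp add: abs_mult)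
    then have "\<bar>k i \<bullet> h j - k j \<bullet> h i\<bar> < 1"
      using eq eh[OF ij] eh[OF ij(2,1)] small by linarith
    then have "k i \<bullet> h j - k j \<bullet> h i = 0"
      using int Ints_nonzero_abs_less1 by blast
    then have "\<bar>(s i - s j) * ?q\<bar> \<le> 4 * \<mu> * H / real R"
      using eq eh[OF ij] eh[OF ij(2,1)] by linarith
    moreover have "\<bar>s i - s j\<bar> * (c * H * H) \<le> \<bar>(s i - s j) * ?q\<bar>"
    proof -
      have "c * H * H \<le> c * norm (h i) * norm (h j)"
        using hk[OF ij(1)] hk[OF ij(2)] pos by (intro mult_mono) auto
      also have "\<dots> \<le> \<bar>?q\<bar>" by (rule cone[OF ij])
      finally show ?thesis unfolding abs_mult by (intro mult_left_mono) auto
    qed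
    ultimately have "\<bar>s i - s j\<bar> * (c * H * H) \<le> 4 * \<mu> * H / real R" by linarith
    then have "\<sigma> * \<bar>real_of_int (i - j)\<bar> / (real R)\<^sup>2 * (c * H * H) \<le> 4 * \<mu> * H / real R"
      unfolding sdiff .
    then have "\<bar>real_of_int (i - j)\<bar> * (\<sigma> * c * H) \<le> 4 * \<mu> * real R"
      using R H by (simp add: field_simps power2_eq_square)
    then show "\<bar>real_of_int (i - j)\<bar> \<le> D"
      using pos H unfolding D_def by (subst pos_le_divide_eq) (auto simp: mult_ac)
  qed
  also have "\<dots> = (16 * B * \<sigma> * H\<^sup>2 + 2) * (D + 1)"
    using R B pos by (simp add: w_def)
  \<comment> \<open>The additive constants are absorbed using 1 <= H^2 and 1 <= \<open>\<mu>\<close>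
    R/H.\<close>
  also have "\<dots> \<le> ((16 * B * \<sigma> + 2) * H\<^sup>2) * ((4 / (c * \<sigma>) + 1) * (\<mu> * real R / H))"
  proof (rule mult_mono)
    have "1 \<le> H\<^sup>2" using pos(6) by (simp add: one_le_power)
    then show "16 * B * \<sigma> * H\<^sup>2 + 2 \<le> (16 * B * \<sigma> + 2) * H\<^sup>2"
      by (simp add: algebra_simps)
    have D: "D = 4 / (c * \<sigma>) * (\<mu> * real R / H)" by (simp add: D_def)
    have "1 \<le> \<mu> * real R / H" using pos(7) H by (simp add: pos_le_divide_eq)
    then show "D + 1 \<le> (4 / (c * \<sigma>) + 1) * (\<mu> * real R / H)"
      unfolding D distrib_right mult_1_left by (rule add_left_mono)
    show "0 \<le> D + 1" using pos H by (simp add: D_def)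
    show "0 \<le> (16 * B * \<sigma> + 2) * H\<^sup>2" using B pos by simp
  qed
  also have "\<dots> = (16 * B * \<sigma> + 2) * (4 / (c * \<sigma>) + 1) * (\<mu> * real R * H)"
    using H by (simp add: power2_eq_square)
  finally show ?thesis .
qed

text \<open>This is a condition on the first minimum of the lattice of vectors (h/R, R(sQh - k)):
  some nonzero one has both components shorter than \<open>\<mu>\<close>. Its negation is the
  hypothesis \<open>sep\<close> of \<open>card_isotropic_le\<close>.\<close>

definition short_vector :: "real^'n^'n \<Rightarrow> nat \<Rightarrow> real \<Rightarrow> real \<Rightarrow> bool" where
  "short_vector Q R s \<mu> \<longleftrightarrow> (\<exists>h\<in>integer_points. \<exists>k\<in>integer_points.
     (h, k) \<noteq> 0 \<and> norm h < \<mu> * real R \<and> real R * norm (s *\<^sub>R (Q *v h) - k) < \<mu>)"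

lemma integer_points_norm_ge_1:
  fixes h :: "real^'n"
  assumes "h \<in> integer_points" "h \<noteq> 0"
  shows "1 \<le> norm h"
proof -
  obtain i where i: "h $ i \<noteq> 0" using assms(2) by (auto simp: vec_eq_iff)
  have "h $ i \<in> \<int>" using assms(1) by (simp add: integer_points_def)
  then have "1 \<le> \<bar>h $ i\<bar>" using i Ints_nonzero_abs_ge1 by blast
  then show ?thesis using component_le_norm_cart[of h i] by linarith
qed

lemma norm_vec_mono:
  fixes x y :: "real^'n"
  assumes "\<And>i. \<bar>x $ i\<bar> \<le> \<bar>y $ i\<bar>"
  shows "norm x \<le> norm y"
  unfolding norm_vec_def by (rule L2_set_mono) (use assms in auto)

text \<open>A matrix without entries between the blocks commutes with restriction to a block, and
  restriction does not increase norms. So a short vector can be restricted to a block on which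
  \<open>h\<close> is nonzero. Such a block exists, since h = 0 would make k a nonzero integer
  vector with R |k| < 1.\<close>

lemma short_vector_block:
  fixes Q :: "real^'n^'n"
  assumes block: "\<And>i j. (i \<in> S) \<noteq> (j \<in> S) \<Longrightarrow> Q $ i $ j = 0"
    and "R > 0" "\<mu> \<le> 1" "short_vector Q R s \<mu>"
  obtains h k where "h \<in> integer_points" "k \<in> integer_points" "h \<noteq> 0" "block_vector S h"
    "norm h < \<mu> * real R" "norm (s *\<^sub>R (Q *v h) - k) \<le> \<mu> / real R"
proof -
  obtain h k where hk: "h \<in> integer_points" "k \<in> integer_points" "(h, k) \<noteq> 0"
    "norm h < \<mu> * real R" "real R * norm (s *\<^sub>R (Q *v h) - k) < \<mu>"
    using assms(4) unfolding short_vector_def by blast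
  have R: "real R \<ge> 1" using assms(2) by simp
  have h0: "h \<noteq> 0"
  proof
    assume h: "h = 0"
    then have "1 \<le> norm k" using hk(2,3) by (intro integer_points_norm_ge_1) (auto simp: zero_prod_def)
    then have "1 * 1 \<le> real R * norm k" using R by (intro mult_mono) auto
    then show False using hk(5) assms(3) h by simp
  qed
  define res where "res = (\<lambda>U (v::real^'n). \<chi> i. if i \<in> U then v $ i else 0)"
  have "\<exists>U. (U = S \<or> U = - S) \<and> res U h \<noteq> 0"
  proof -
    obtain i where "h $ i \<noteq> 0" using h0 by (auto simp: vec_eq_iff)
    then show ?thesis
      by (cases "i \<in> S"; intro exI[of _ "if i \<in> S then S else - S"]) (auto simp: res_def vec_eq_iff)
  qed
  then obtain U where U: "U = S \<or> U = - S" "res U h \<noteq> 0" by blast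
  have "s *\<^sub>R (Q *v res U h) - res U k = res U (s *\<^sub>R (Q *v h) - k)"
  proof -
    have "(Q *v res U h) $ i = (if i \<in> U then (Q *v h) $ i else 0)" for i
      unfolding matrix_vector_mult_def res_def using U(1) block
      by (auto intro!: sum.cong sum.neutral)
    then show ?thesis by (simp add: res_def vec_eq_iff)
  qed
  moreover have "norm (res U v) \<le> norm v" for v
    by (rule norm_vec_mono) (simp add: res_def)
  ultimately have le: "norm (s *\<^sub>R (Q *v res U h) - res U k) \<le> norm (s *\<^sub>R (Q *v h) - k)"
    "norm (res U h) \<le> norm h" by simp_all
  have "norm (s *\<^sub>R (Q *v h) - k) \<le> \<mu> / real R"
    using hk(5) R by (subst pos_le_divide_eq) (auto simp: mult.commute)
  then show ?thesis
    using that[of "res U h" "res U k"] le hk U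
    by (auto simp: integer_points_def res_def block_vector_def)
qed

lemma dyadic_bracket:
  fixes x :: real
  assumes "1 \<le> x"
  obtains l :: nat where "2 ^ l \<le> x" "x < 2 ^ Suc l"
proof -
  obtain m :: nat where m: "x < 2 ^ m" using real_arch_pow[of 2 x] by auto
  define n where "n = (LEAST m. x < 2 ^ m)"
  have n: "x < 2 ^ n" unfolding n_def using m by (rule LeastI)
  have "n \<noteq> 0" using n assms by (cases n) auto
  then obtain l where l: "n = Suc l" by (cases n) auto
  have "\<not> x < 2 ^ l" using not_less_Least[of l "\<lambda>m. x < 2 ^ m"] l n_def by simp
  then show ?thesis using that[of l] n l by simp
qed

text \<open>The resonances are sorted by the dyadic size 2^l and the cone of a block vector
  \<open>h\<close>. One class contributes at most a constant times \<open>\<mu>\<close> R 2^l, and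
  the geometric sum over 2^l < \<open>\<mu>\<close> R gives the square.\<close>

lemma card_short_vector_le:
  fixes Q :: "real^'n^'n"
  assumes sym: "symmetric_matrix Q" and \<sigma>: "\<sigma> > 0"
    and block: "\<And>i j. (i \<in> S) \<noteq> (j \<in> S) \<Longrightarrow> Q $ i $ j = 0"
    and definite: "\<And>u. u \<noteq> 0 \<Longrightarrow> block_vector S u \<Longrightarrow> quad Q u \<noteq> 0"
  obtains C where "C > 0" "\<And>R \<mu> n. R > 0 \<Longrightarrow> \<mu> > 0 \<Longrightarrow> \<mu> * real R = 2 ^ n \<Longrightarrow>
    real (card {j \<in> {- int (R\<^sup>2)<..<int (R\<^sup>2)}. short_vector Q R (\<sigma> * of_int j / (real R)\<^sup>2) \<mu>})
      \<le> C * (\<mu> * real R)\<^sup>2"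
proof -
  obtain B where B: "B > 0" "\<And>x. norm (Q *v x) \<le> B * norm x"
    using matrix_vector_bound by metis
  obtain c T and col :: "real^'n \<Rightarrow> real^'n"
    where c: "c > 0" and T: "finite T" "\<And>u. u \<noteq> 0 \<Longrightarrow> block_vector S u \<Longrightarrow> col u \<in> T"
      and cone: "\<And>u v. u \<noteq> 0 \<Longrightarrow> v \<noteq> 0 \<Longrightarrow> block_vector S u \<Longrightarrow> block_vector S v \<Longrightarrow> col u = col v \<Longrightarrow>
      c * norm u * norm v \<le> \<bar>(Q *v u) \<bullet> v\<bar>"
    using definite_cone_cover[of S Q] definite by metis
  define C1 where "C1 = (16 * B * \<sigma> + 2) * (4 / (c * \<sigma>) + 1)"
  have C1: "C1 > 0" using B c \<sigma> by (simp add: C1_def add_pos_pos)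
  show thesis
  proof (rule that[of "32 + real (card T) * C1"])
    show "32 + real (card T) * C1 > 0" using C1 by (simp add: add_pos_nonneg)
  next
    fix R n :: nat and \<mu> :: real
    assume R: "R > 0" and \<mu>: "\<mu> > 0" and n: "\<mu> * real R = 2 ^ n"
    define s where "s = (\<lambda>j. \<sigma> * of_int j / (real R)\<^sup>2)"
    define I where "I = {- int (R\<^sup>2)<..<int (R\<^sup>2)}"
    define A where "A = {j \<in> I. short_vector Q R (s j) \<mu>}"
    have "real (card A) \<le> (32 + real (card T) * C1) * (\<mu> * real R)\<^sup>2"
    proof (cases "\<mu> \<le> 1/4")
      \<comment> \<open>For \<open>\<mu>\<close> > 1/4 the trivial count 2 R^2 = 32 (R/4)^2 is
        already good enough.\<close>
      case False
      have "card A \<le> card I" unfolding A_def I_def by (intro card_mono) auto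
      also have "card I \<le> 2 * R\<^sup>2" by (simp add: I_def nat_le_iff)
      finally have "real (card A) \<le> real (2 * R\<^sup>2)" by (rule of_nat_mono)
      also have "\<dots> = 32 * (1/4 * real R)\<^sup>2" by (simp add: power2_eq_square)
      also have "\<dots> \<le> 32 * (\<mu> * real R)\<^sup>2"
        using False by (intro mult_left_mono power_mono mult_right_mono) auto
      also have "\<dots> \<le> (32 + real (card T) * C1) * (\<mu> * real R)\<^sup>2"
        using C1 by (intro mult_right_mono) auto
      finally show ?thesis .
    next
      case True
      then have \<mu>1: "\<mu> \<le> 1" by simp
      define P where "P = (\<lambda>l t j h k. h \<in> integer_points \<and> k \<in> integer_points \<and> h \<noteq> 0 \<and> block_vector S h \<and>
          2 ^ l \<le> norm h \<and> norm h < 2 ^ Suc l \<and> norm (s j *\<^sub>R (Q *v h) - k) \<le> \<mu> / real R \<and> col h = t)"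
      define E where "E = (\<lambda>l t. {j \<in> I. \<exists>h k. P l t j h k})"
      have finE: "finite (E l t)" for l t
        by (rule finite_subset[of _ I]) (auto simp: E_def I_def)
      have cardE: "real (card (E l t)) \<le> C1 * (\<mu> * real R * 2 ^ l)" if l: "l < n" for l t
      proof -
        have "\<forall>j\<in>E l t. \<exists>h k. P l t j h k" by (simp add: E_def)
        then obtain h k where hk: "\<And>j. j \<in> E l t \<Longrightarrow> P l t j (h j) (k j)" by metis
        have "(2::real) ^ l \<le> 2 ^ n" using l by (intro power_increasing) auto
        then have H: "2 ^ l \<le> \<mu> * real R" using n by simp
        show ?thesis
          unfolding C1_def
        proof (rule card_near_resonances_le[OF sym B c \<sigma> R \<mu> True _ H])
          show "E l t \<subseteq> {- int (R\<^sup>2)<..<int (R\<^sup>2)}" unfolding E_def I_def by blast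
        next
          fix j assume "j \<in> E l t"
          from hk[OF this] show "h j \<in> integer_points \<and> k j \<in> integer_points \<and> 2 ^ l \<le> norm (h j) \<and>
              norm (h j) \<le> 2 * 2 ^ l \<and> norm ((\<sigma> * of_int j / (real R)\<^sup>2) *\<^sub>R (Q *v h j) - k j) \<le> \<mu> / real R"
            unfolding P_def s_def by simp
        next
          fix i j assume "i \<in> E l t" "j \<in> E l t"
          from hk[OF this(1)] hk[OF this(2)] show "c * norm (h i) * norm (h j) \<le> \<bar>(Q *v h i) \<bullet> h j\<bar>"
            unfolding P_def by (intro cone) auto
        qed simp
      qed
      have "A \<subseteq> (\<Union>p\<in>{..<n} \<times> T. E (fst p) (snd p))"
      proof
        fix j assume j: "j \<in> A"
        then have "short_vector Q R (s j) \<mu>" by (simp add: A_def)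
        then obtain h k where hk: "h \<in> integer_points" "k \<in> integer_points" "h \<noteq> 0" "block_vector S h"
          "norm h < \<mu> * real R" "norm (s j *\<^sub>R (Q *v h) - k) \<le> \<mu> / real R"
          using short_vector_block[of S Q R \<mu> "s j", OF block R \<mu>1] by metis
        obtain l where l: "2 ^ l \<le> norm h" "norm h < 2 ^ Suc l"
          using dyadic_bracket[OF integer_points_norm_ge_1[OF hk(1,3)]] by blast
        have "(2::real) ^ l < 2 ^ n" using l(1) hk(5) n by linarith
        then have "l < n" by simp
        moreover have "P l (col h) j h k" using hk l by (simp add: P_def)
        then have "j \<in> E l (col h)" using j by (auto simp: E_def A_def)
        moreover have "col h \<in> T" using T(2) hk by blast
        ultimately show "j \<in> (\<Union>p\<in>{..<n} \<times> T. E (fst p) (snd p))"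
          by (intro UN_I[of "(l, col h)"]) auto
      qed
      then have "card A \<le> card (\<Union>p\<in>{..<n} \<times> T. E (fst p) (snd p))"
        using T(1) by (intro card_mono finite_UN_I finE) auto
      also have "\<dots> \<le> (\<Sum>p\<in>{..<n} \<times> T. card (E (fst p) (snd p)))"
        using T(1) by (intro card_UN_le) auto
      finally have "real (card A) \<le> real (\<Sum>p\<in>{..<n} \<times> T. card (E (fst p) (snd p)))"
        by (rule of_nat_mono)
      also have "\<dots> = (\<Sum>p\<in>{..<n} \<times> T. real (card (E (fst p) (snd p))))" by (rule of_nat_sum)
      also have "\<dots> \<le> (\<Sum>(l,t)\<in>{..<n} \<times> T. C1 * (\<mu> * real R * 2 ^ l))"
        using cardE by (intro sum_mono) auto
      also have "\<dots> = (\<Sum>l<n. \<Sum>t\<in>T. C1 * (\<mu> * real R * 2 ^ l))"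
        by (rule sum.cartesian_product[symmetric])
      also have "\<dots> = real (card T) * C1 * (\<mu> * real R) * (\<Sum>l<n. 2 ^ l)"
        by (simp add: sum_distrib_left mult_ac)
      also have "(\<Sum>l<n. (2::real) ^ l) = 2 ^ n - 1" by (simp add: geometric_sum)
      also have "real (card T) * C1 * (\<mu> * real R) * (2 ^ n - 1) \<le> real (card T) * C1 * (\<mu> * real R) * (\<mu> * real R)"
        using C1 \<mu> n by (intro mult_left_mono) auto
      also have "\<dots> = real (card T) * C1 * (\<mu> * real R)\<^sup>2" by (simp add: power2_eq_square)
      also have "\<dots> \<le> (32 + real (card T) * C1) * (\<mu> * real R)\<^sup>2"
        by (intro mult_right_mono) auto
      finally show ?thesis .
    qed
    then show "real (card {j \<in> {- int (R\<^sup>2)<..<int (R\<^sup>2)}. short_vector Q R (\<sigma> * of_int j / (real R)\<^sup>2) \<mu>})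
      \<le> (32 + real (card T) * C1) * (\<mu> * real R)\<^sup>2"
      by (simp add: A_def I_def s_def)
  qed
qed

section \<open>Counting integer points\<close>

lemma sum_difference_le:
  fixes f :: "int \<Rightarrow> real"
  assumes "\<And>i. f i \<ge> 0"
  shows "(\<Sum>i\<in>{0..<int J}. \<Sum>j\<in>{0..<int J}. f (i - j)) \<le> real J * (\<Sum>i\<in>{- int J<..<int J}. f i)"
proof -
  have "(\<Sum>i\<in>{0..<int J}. \<Sum>j\<in>{0..<int J}. f (i - j)) \<le> (\<Sum>i\<in>{0..<int J}. \<Sum>i\<in>{- int J<..<int J}. f i)"
  proof (rule sum_mono)
    fix i assume i: "i \<in> {0..<int J}"
    have "(\<Sum>j\<in>{0..<int J}. f (i - j)) = (\<Sum>l\<in>(\<lambda>j. i - j) ` {0..<int J}. f l)"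
      by (subst sum.reindex) (auto simp: inj_on_def)
    also have "\<dots> \<le> (\<Sum>i\<in>{- int J<..<int J}. f i)"
      using i assms by (intro sum_mono2) auto
    finally show "(\<Sum>j\<in>{0..<int J}. f (i - j)) \<le> (\<Sum>i\<in>{- int J<..<int J}. f i)" .
  qed
  then show ?thesis by simp
qed

text \<open>All angles lie in [0, pi/3], so every real part is at least 1/2 and nothing
  cancels.\<close>

lemma norm_sum_cis_ge:
  assumes "\<And>j. j \<in> A \<Longrightarrow> 0 \<le> f j \<and> f j \<le> 1"
  shows "real (card A) / 2 \<le> norm (\<Sum>j\<in>A. cis (f j))"
proof -
  have "1/2 \<le> cos (f j)" if "j \<in> A" for j
  proof -
    have "cos (pi/3) \<le> cos (f j)"
      using assms[OF that] pi_gt3 by (intro cos_monotone_0_pi_le) auto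
    then show ?thesis by (simp add: cos_60)
  qed
  then have "(\<Sum>j\<in>A. 1/2) \<le> (\<Sum>j\<in>A. cos (f j))" by (rule sum_mono)
  also have "\<dots> = Re (\<Sum>j\<in>A. cis (f j))" by simp
  also have "\<dots> \<le> norm (\<Sum>j\<in>A. cis (f j))" by (rule complex_Re_le_cmod)
  finally show ?thesis by simp
qed

text \<open>The squared modulus of an exponential sum over R^2 frequencies is nonnegative everywhere
  and at least (R^2/2)^2 on the shell, so it majorizes the indicator of the shell up to this factor.
  Expanding it yields theta sums at differences of the frequencies.\<close>

lemma card_shell_le_sum_theta:
  fixes Q :: "real^'n^'n" and M :: "real^'n"
  assumes "a < b" "R > 0" and \<sigma>: "\<sigma> = 1 / (pi * (b - a))"
  shows "(real (R\<^sup>2))\<^sup>2 / 4 * real (2 * R + 1) ^ CARD('n) *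
      real (card {x \<in> grid {- int R..int R}. a \<le> quad Q (x - M) \<and> quad Q (x - M) \<le> b})
    \<le> real (R\<^sup>2) * (\<Sum>j\<in>{- int (R\<^sup>2)<..<int (R\<^sup>2)}. norm (theta Q M R (\<sigma> * of_int j / (real R)\<^sup>2)))"
proof -
  define J where "J = R\<^sup>2"
  define X :: "(real^'n) set" where "X = grid {- int (2 * R)..int (2 * R)}"
  define B :: "(real^'n) set" where "B = grid {- int R..int R}"
  define G where "G = {x \<in> B. a \<le> quad Q (x - M) \<and> quad Q (x - M) \<le> b}"
  define s where "s = (\<lambda>j::int. \<sigma> * of_int j / (real R)\<^sup>2)"
  define \<xi> where "\<xi> = (\<lambda>p. quad Q (fst p + snd p - M) - a)"
  define W where "W = X \<times> B"
  define A where "A = {0..<int J}"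
  define T where "T = (\<Sum>p\<in>W. (norm (\<Sum>j\<in>A. cis (pi * s j * \<xi> p)))\<^sup>2)"
  have fin: "finite X" "finite B" "finite W" "finite G"
    by (auto simp: X_def B_def W_def G_def finite_grid)
  have R: "real R > 0" using assms(2) by simp
  have cA: "card A = J" by (simp add: A_def)
  \<comment> \<open>Each point \<open>z\<close> of the shell enters once for every \<open>y\<close>
    in \<open>B\<close>, as the pair (z - y, y).\<close>
  have "real (card G) * real (card B) * (real J / 2)\<^sup>2 = (\<Sum>p\<in>(\<lambda>(z, y). (z - y, y)) ` (G \<times> B). (real J / 2)\<^sup>2)"
    by (subst sum.reindex) (auto simp: inj_on_def card_cartesian_product)
  also have "\<dots> \<le> (\<Sum>p\<in>(\<lambda>(z, y). (z - y, y)) ` (G \<times> B). (norm (\<Sum>j\<in>A. cis (pi * s j * \<xi> p)))\<^sup>2)"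
  proof (rule sum_mono)
    fix p assume "p \<in> (\<lambda>(z, y). (z - y, y)) ` (G \<times> B)"
    then obtain z y where p: "p = (z - y, y)" "z \<in> G" by auto
    have \<xi>: "0 \<le> \<xi> p" "\<xi> p \<le> b - a" using p by (auto simp: \<xi>_def G_def)
    have "real (card A) / 2 \<le> norm (\<Sum>j\<in>A. cis (pi * s j * \<xi> p))"
    proof (rule norm_sum_cis_ge)
      fix j assume j: "j \<in> A"
      have "0 \<le> j" "j \<le> int J" using j by (auto simp: A_def)
      then have j0: "0 \<le> real_of_int j" "real_of_int j \<le> (real R)\<^sup>2"
        by (auto simp: J_def simp flip: of_nat_power)
      \<comment> \<open>\<open>\<sigma>\<close> is chosen so that the phase becomes a product of two
        numbers in [0, 1].\<close>
      have eq: "pi * s j * \<xi> p = (real_of_int j / (real R)\<^sup>2) * (\<xi> p / (b - a))"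
        using assms(1) by (simp add: s_def \<sigma>)
      have "0 \<le> real_of_int j / (real R)\<^sup>2" "real_of_int j / (real R)\<^sup>2 \<le> 1" using j0 R by simp_all
      moreover have "0 \<le> \<xi> p / (b - a)" "\<xi> p / (b - a) \<le> 1" using \<xi> assms(1) by simp_all
      ultimately show "0 \<le> pi * s j * \<xi> p \<and> pi * s j * \<xi> p \<le> 1"
        unfolding eq by (intro conjI mult_nonneg_nonneg mult_le_one)
    qed
    then show "(real J / 2)\<^sup>2 \<le> (norm (\<Sum>j\<in>A. cis (pi * s j * \<xi> p)))\<^sup>2"
      unfolding cA by (rule power_mono) simp
  qed
  also have "\<dots> \<le> T"
    unfolding T_def
  proof (rule sum_mono2)
    show "(\<lambda>(z, y). (z - y, y)) ` (G \<times> B) \<subseteq> W"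
    proof safe
      fix z y assume zy: "z \<in> G" "y \<in> B"
      have "\<bar>(z - y) $ i\<bar> \<le> real (2 * R)" for i
      proof -
        have "\<bar>z $ i\<bar> \<le> real R" "\<bar>y $ i\<bar> \<le> real R"
          using zy by (auto simp: G_def B_def grid_symmetric_iff)
        then show ?thesis by simp
      qed
      moreover have "z - y \<in> integer_points"
        using zy by (intro integer_points_diff) (auto simp: G_def B_def grid_symmetric_iff)
      ultimately have "z - y \<in> X" unfolding X_def grid_symmetric_iff by blast
      then show "(z - y, y) \<in> W" using zy by (simp add: W_def)
    qed
  qed (use fin in auto)
  finally have lower: "real (card G) * real (card B) * (real J / 2)\<^sup>2 \<le> T" .
  have sd: "s i - s j = s (i - j)" for i j
    by (simp add: s_def diff_divide_distrib right_diff_distrib)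
  have sq: "complex_of_real ((norm (\<Sum>j\<in>A. cis (pi * s j * x)))\<^sup>2) = (\<Sum>i\<in>A. \<Sum>j\<in>A. cis (pi * s (i - j) * x))" for x
  proof -
    have "complex_of_real ((norm (\<Sum>j\<in>A. cis (pi * s j * x)))\<^sup>2)
        = (\<Sum>j\<in>A. cis (pi * s j * x)) * cnj (\<Sum>j\<in>A. cis (pi * s j * x))"
      by (rule complex_norm_square)
    also have "\<dots> = (\<Sum>i\<in>A. \<Sum>j\<in>A. cis (pi * s i * x) * cnj (cis (pi * s j * x)))"
      by (simp only: cnj_sum sum_product)
    also have "\<dots> = (\<Sum>i\<in>A. \<Sum>j\<in>A. cis (pi * s (i - j) * x))"
      by (intro sum.cong refl, simp only: cis_cnj cis_mult sd[symmetric])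
         (rule arg_cong[where f=cis], simp add: algebra_simps)
    finally show ?thesis .
  qed
  have "complex_of_real T = (\<Sum>p\<in>W. \<Sum>i\<in>A. \<Sum>j\<in>A. cis (pi * s (i - j) * \<xi> p))"
    unfolding T_def of_real_sum sq ..
  also have "\<dots> = (\<Sum>i\<in>A. \<Sum>p\<in>W. \<Sum>j\<in>A. cis (pi * s (i - j) * \<xi> p))"
    by (rule sum.swap)
  also have "\<dots> = (\<Sum>i\<in>A. \<Sum>j\<in>A. \<Sum>p\<in>W. cis (pi * s (i - j) * \<xi> p))"
    by (rule sum.cong[OF refl], rule sum.swap)
  also have "\<dots> = (\<Sum>i\<in>A. \<Sum>j\<in>A. cis (- (pi * s (i - j) * a)) * theta Q M R (s (i - j)))"
  proof (intro sum.cong refl)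
    fix i j
    have "(\<Sum>p\<in>W. cis (pi * s (i - j) * \<xi> p))
        = (\<Sum>p\<in>W. cis (- (pi * s (i - j) * a)) * cis (pi * s (i - j) * quad Q (fst p + snd p - M)))"
      unfolding cis_mult \<xi>_def
      by (intro sum.cong refl arg_cong[where f=cis]) (simp add: algebra_simps)
    also have "\<dots> = cis (- (pi * s (i - j) * a)) * (\<Sum>p\<in>W. cis (pi * s (i - j) * quad Q (fst p + snd p - M)))"
      by (simp only: sum_distrib_left)
    also have "(\<Sum>p\<in>W. cis (pi * s (i - j) * quad Q (fst p + snd p - M))) = theta Q M R (s (i - j))"
      unfolding theta_def W_def X_def B_def sum.cartesian_product by (simp add: case_prod_beta)
    finally show "(\<Sum>p\<in>W. cis (pi * s (i - j) * \<xi> p)) = cis (- (pi * s (i - j) * a)) * theta Q M R (s (i - j))" .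
  qed
  finally have T: "complex_of_real T = (\<Sum>i\<in>A. \<Sum>j\<in>A. cis (- (pi * s (i - j) * a)) * theta Q M R (s (i - j)))" .
  have "T \<le> norm (complex_of_real T)" by simp
  also have "\<dots> \<le> (\<Sum>i\<in>A. \<Sum>j\<in>A. norm (cis (- (pi * s (i - j) * a)) * theta Q M R (s (i - j))))"
    unfolding T by (intro order.trans[OF norm_sum] sum_mono order_refl)
  also have "\<dots> = (\<Sum>i\<in>A. \<Sum>j\<in>A. norm (theta Q M R (s (i - j))))"
    by (simp add: norm_mult)
  also have "\<dots> \<le> real J * (\<Sum>i\<in>{- int J<..<int J}. norm (theta Q M R (s i)))"
    unfolding A_def by (rule sum_difference_le) simp
  finally have "real (card G) * real (card B) * (real J / 2)\<^sup>2
      \<le> real J * (\<Sum>i\<in>{- int J<..<int J}. norm (theta Q M R (s i)))"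
    using lower by linarith
  moreover have "card B = (2 * R + 1) ^ CARD('n)"
    by (simp add: B_def card_grid nat_add_distrib nat_mult_distrib)
  ultimately show ?thesis
    by (simp add: G_def B_def J_def s_def power_divide mult_ac)
qed

section \<open>Dyadic summation over the resonance scales\<close>

lemma sum_power_le:
  fixes \<rho> :: real
  assumes "\<rho> \<ge> 5/4"
  shows "(\<Sum>i\<le>m. \<rho> ^ i) \<le> 5 * \<rho> ^ m"
proof (induction m)
  case (Suc m)
  have "5 * \<rho> ^ m \<le> 4 * \<rho> * \<rho> ^ m" using assms by (intro mult_right_mono) auto
  then show ?case using Suc by simp
qed simp

text \<open>The dyadic descent stops here: at scale 1/R the vector h has norm below 1, hence is 0,
  and then so is k.\<close>

lemma not_short_vector:
  fixes Q :: "real^'n^'n"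
  assumes "R > 0"
  shows "\<not> short_vector Q R s (1 / real R)"
proof
  assume "short_vector Q R s (1 / real R)"
  then obtain h k where hk: "h \<in> integer_points" "k \<in> integer_points" "(h, k) \<noteq> 0"
    "norm h < 1 / real R * real R" "real R * norm (s *\<^sub>R (Q *v h) - k) < 1 / real R"
    unfolding short_vector_def by blast
  have R: "real R \<ge> 1" using assms by simp
  have h: "h = 0" using integer_points_norm_ge_1[OF hk(1)] hk(4) R by force
  then have "1 \<le> norm k" using hk(2,3) by (intro integer_points_norm_ge_1) (auto simp: zero_prod_def)
  then have "1 * 1 \<le> real R * norm k" using R by (intro mult_mono) auto
  moreover have "1 / real R \<le> 1" using R by simp
  ultimately show False using hk(5) h by simp
qed

lemma theta_norm_le:
  fixes Q :: "real^'n^'n"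
  assumes "symmetric_matrix Q" "R > 0" "\<not> short_vector Q R s (1 / 2 ^ i)"
  shows "norm (theta Q M R s)
    \<le> sqrt ((211200 * (real CARD('n))\<^sup>2) ^ CARD('n)) * sqrt (real R ^ (3 * CARD('n))) * sqrt (2 ^ CARD('n)) ^ i"
proof -
  let ?d = "CARD('n)"
  have "(norm (theta Q M R s))\<^sup>2 \<le> (19200 * real ?d * real R ^ 3) ^ ?d * (11 * real ?d / (1 / 2 ^ i)) ^ ?d"
  proof (rule theta_norm_sq_le[OF assms(1,2) refl])
    fix F :: "((real^'n) \<times> (real^'n)) set"
    assume "finite F" and F: "\<And>h k. (h, k) \<in> F \<Longrightarrow> h \<in> integer_points \<and> k \<in> integer_points \<and>
      (\<forall>i. \<bar>h $ i\<bar> \<le> 4 * real R) \<and> (\<forall>i. \<bar>(s *\<^sub>R (Q *v h) - k) $ i\<bar> \<le> 1 / real (16 * CARD('n) * R))"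
    show "real (card F) \<le> (11 * real ?d / (1 / 2 ^ i)) ^ ?d"
    proof (rule card_isotropic_le[OF assms(1,2) _ _ \<open>finite F\<close> F])
      fix h k :: "real^'n" assume hk: "h \<in> integer_points" "k \<in> integer_points" "(h, k) \<noteq> 0"
      show "1 / 2 ^ i * real R \<le> norm h \<or> 1 / 2 ^ i \<le> real R * norm (s *\<^sub>R (Q *v h) - k)"
        using assms(3) hk unfolding short_vector_def by (meson not_less)
    qed auto
  qed
  also have "\<dots> = (211200 * (real ?d)\<^sup>2 * real R ^ 3 * 2 ^ i) ^ ?d"
    by (subst power_mult_distrib[symmetric]) (simp add: power2_eq_square mult_ac)
  also have "\<dots> = (211200 * (real ?d)\<^sup>2) ^ ?d * real R ^ (3 * ?d) * (2 ^ ?d) ^ i"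
    by (simp add: power_mult_distrib power_mult[symmetric] mult.commute)
  finally have "(norm (theta Q M R s))\<^sup>2 \<le> (211200 * (real ?d)\<^sup>2) ^ ?d * real R ^ (3 * ?d) * (2 ^ ?d) ^ i" .
  then have "norm (theta Q M R s) \<le> sqrt ((211200 * (real ?d)\<^sup>2) ^ ?d * real R ^ (3 * ?d) * (2 ^ ?d) ^ i)"
    by (rule real_le_rsqrt)
  also have "\<dots> = sqrt ((211200 * (real ?d)\<^sup>2) ^ ?d) * sqrt (real R ^ (3 * ?d)) * sqrt (2 ^ ?d) ^ i"
    by (simp only: real_sqrt_mult real_sqrt_power)
  finally show ?thesis .
qed

text \<open>The frequencies are layered by the first scale 2^(-i) without a short vector. Layer i
  has O(R^2/4^i) members, on each of which theta is O(R^(3d/2) 2^(id/2)), so the layers form a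
  geometric series with ratio \<open>\<rho>\<close> = 2^(d/2)/4.\<close>

lemma sum_theta_le:
  fixes Q :: "real^'n^'n"
  assumes dim: "CARD('n) \<ge> 5" and sym: "symmetric_matrix Q" and \<sigma>: "\<sigma> > 0"
    and block: "\<And>i j. (i \<in> S) \<noteq> (j \<in> S) \<Longrightarrow> Q $ i $ j = 0"
    and definite: "\<And>u. u \<noteq> 0 \<Longrightarrow> block_vector S u \<Longrightarrow> quad Q u \<noteq> 0"
  obtains C where "C > 0" "\<And>m R. R = 2 ^ m \<Longrightarrow>
    (\<Sum>j\<in>{- int (R\<^sup>2)<..<int (R\<^sup>2)}. norm (theta Q M R (\<sigma> * of_int j / (real R)\<^sup>2))) \<le> C * real R ^ (2 * CARD('n))"
proof -
  let ?d = "CARD('n)"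
  obtain C1 where C1: "C1 > 0" "\<And>R \<mu> n. R > 0 \<Longrightarrow> \<mu> > 0 \<Longrightarrow> \<mu> * real R = 2 ^ n \<Longrightarrow>
    real (card {j \<in> {- int (R\<^sup>2)<..<int (R\<^sup>2)}. short_vector Q R (\<sigma> * of_int j / (real R)\<^sup>2) \<mu>})
      \<le> C1 * (\<mu> * real R)\<^sup>2"
    by (rule card_short_vector_le[OF sym \<sigma> block definite]) (assumption | rule that)+
  define K where "K = sqrt ((211200 * (real ?d)\<^sup>2) ^ ?d)"
  define q where "q = sqrt (2 ^ ?d)"
  define \<rho> where "\<rho> = q / 4"
  have "0 < K" by (simp add: K_def)
  \<comment> \<open>This is where d >= 5 enters: 2^d >= 32 > 25 makes the ratio at least 5/4, so the
    last layer dominates. For d = 4 the ratio would be 1 and a logarithm would appear.\<close>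
  have "sqrt (5\<^sup>2) \<le> q"
    unfolding q_def
  proof (rule real_sqrt_le_mono)
    have "(5::real)\<^sup>2 \<le> 2 ^ 5" by simp
    also have "\<dots> \<le> 2 ^ ?d" using dim by (intro power_increasing) auto
    finally show "(5::real)\<^sup>2 \<le> 2 ^ ?d" .
  qed
  then have q: "q \<ge> 5" by simp
  then have \<rho>: "\<rho> \<ge> 5/4" by (simp add: \<rho>_def)
  show thesis
  proof (rule that[of "K * (4 * C1 + 2) * 5"])
    show "K * (4 * C1 + 2) * 5 > 0" using \<open>0 < K\<close> C1(1) by simp
  next
    fix m R :: nat assume R: "R = 2 ^ m"
    define s where "s = (\<lambda>j::int. \<sigma> * of_int j / (real R)\<^sup>2)"
    define I where "I = {- int (R\<^sup>2)<..<int (R\<^sup>2)}"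
    \<comment> \<open>By minimality of i, a short vector still exists at the preceding scale 2/2^i.
      For i = 0 there is no preceding scale and hence no condition.\<close>
    define P where "P = (\<lambda>i j. i = 0 \<or> short_vector Q R (s j) (2 / 2 ^ i))"
    define L where "L = K * sqrt (real R ^ (3 * ?d))"
    have R0: "R > 0" by (simp add: R)
    have L0: "L \<ge> 0" using \<open>0 < K\<close> by (simp add: L_def)
    have pointwise: "norm (theta Q M R (s j)) \<le> (\<Sum>i\<le>m. if P i j then L * q ^ i else 0)" for j
    proof -
      define i where "i = (LEAST i. \<not> short_vector Q R (s j) (1 / 2 ^ i))"
      have m: "\<not> short_vector Q R (s j) (1 / 2 ^ m)"
        using not_short_vector[OF R0, of Q "s j"] by (simp add: R)
      have i: "\<not> short_vector Q R (s j) (1 / 2 ^ i)" "i \<le> m"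
        unfolding i_def using m by (rule LeastI, rule Least_le)
      have "P i j"
      proof (cases i)
        case (Suc i')
        then have "short_vector Q R (s j) (1 / 2 ^ i')"
          using not_less_Least[of i' "\<lambda>i. \<not> short_vector Q R (s j) (1 / 2 ^ i)"] i_def by simp
        moreover have "1 / 2 ^ i' = (2::real) / 2 ^ i" by (simp add: Suc)
        ultimately show ?thesis by (simp add: P_def)
      qed (simp add: P_def)
      have "norm (theta Q M R (s j)) \<le> L * q ^ i"
        unfolding L_def K_def q_def by (rule theta_norm_le[OF sym R0 i(1)])
      also have "\<dots> = (if P i j then L * q ^ i else 0)" using \<open>P i j\<close> by simp
      also have "\<dots> \<le> (\<Sum>i\<le>m. if P i j then L * q ^ i else 0)"
        using i(2) L0 q by (intro member_le_sum) auto
      finally show ?thesis .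
    qed
    have cardP: "real (card {j \<in> I. P i j}) \<le> (4 * C1 + 2) * ((real R)\<^sup>2 / 4 ^ i)" if i: "i \<le> m" for i
    proof (cases "i = 0")
      case True
      have "{j \<in> I. P i j} = I" using True by (simp add: P_def)
      moreover have "card I \<le> 2 * R\<^sup>2" by (simp add: I_def nat_le_iff)
      ultimately have "card {j \<in> I. P i j} \<le> 2 * R\<^sup>2" by simp
      then have "real (card {j \<in> I. P i j}) \<le> 2 * (real R)\<^sup>2" by (simp flip: of_nat_power of_nat_mult)
      also have "\<dots> \<le> (4 * C1 + 2) * (real R)\<^sup>2" using C1(1) by (intro mult_right_mono) auto
      finally show ?thesis using True by simp
    next
      case False
      have "{j \<in> I. P i j} = {j \<in> {- int (R\<^sup>2)<..<int (R\<^sup>2)}. short_vector Q R (\<sigma> * of_int j / (real R)\<^sup>2) (2 / 2 ^ i)}"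
        using False by (simp add: P_def I_def s_def)
      moreover have "2 / 2 ^ i * real R = 2 ^ (m + 1 - i)"
        using i by (simp add: R power_diff)
      ultimately have "real (card {j \<in> I. P i j}) \<le> C1 * (2 / 2 ^ i * real R)\<^sup>2"
        using C1(2)[OF R0, of "2 / 2 ^ i" "m + 1 - i"] by simp
      also have "\<dots> = 4 * C1 * ((real R)\<^sup>2 / 4 ^ i)"
      proof -
        have "((2::real) ^ i)\<^sup>2 = 4 ^ i" by (simp add: power2_eq_square flip: power_mult_distrib)
        then show ?thesis by (simp add: power_mult_distrib power_divide)
      qed
      also have "\<dots> \<le> (4 * C1 + 2) * ((real R)\<^sup>2 / 4 ^ i)" by (intro mult_right_mono) auto
      finally show ?thesis .
    qed
    have "(\<Sum>j\<in>I. norm (theta Q M R (s j))) \<le> (\<Sum>j\<in>I. \<Sum>i\<le>m. if P i j then L * q ^ i else 0)"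
      by (intro sum_mono pointwise)
    also have "\<dots> = (\<Sum>i\<le>m. \<Sum>j\<in>I. if P i j then L * q ^ i else 0)"
      by (rule sum.swap)
    also have "\<dots> = (\<Sum>i\<le>m. real (card {j \<in> I. P i j}) * (L * q ^ i))"
    proof (rule sum.cong[OF refl])
      fix i
      have "(\<Sum>j\<in>I. if P i j then L * q ^ i else 0) = (\<Sum>j\<in>{j \<in> I. P i j}. L * q ^ i)"
        by (rule sum.inter_filter[symmetric]) (simp add: I_def)
      then show "(\<Sum>j\<in>I. if P i j then L * q ^ i else 0) = real (card {j \<in> I. P i j}) * (L * q ^ i)"
        by simp
    qed
    also have "\<dots> \<le> (\<Sum>i\<le>m. ((4 * C1 + 2) * ((real R)\<^sup>2 / 4 ^ i)) * (L * q ^ i))"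
      using cardP L0 q by (intro sum_mono mult_right_mono) auto
    also have "\<dots> = L * (4 * C1 + 2) * (real R)\<^sup>2 * (\<Sum>i\<le>m. \<rho> ^ i)"
      by (simp add: sum_distrib_left \<rho>_def power_divide mult_ac)
    also have "\<dots> \<le> L * (4 * C1 + 2) * (real R)\<^sup>2 * (5 * \<rho> ^ m)"
      using sum_power_le[OF \<rho>] L0 C1(1) by (intro mult_left_mono) auto
    also have "\<dots> = L * (4 * C1 + 2) * 5 * ((real R)\<^sup>2 * \<rho> ^ m)" by simp
    \<comment> \<open>As R = 2^m, the factor R^2 cancels the powers of 4 in
      \<open>\<rho> ^ m\<close> and leaves 2^(dm/2) = R^(d/2).\<close>
    also have "(real R)\<^sup>2 * \<rho> ^ m = sqrt (real R ^ ?d)"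
    proof -
      have "(real R)\<^sup>2 = 4 ^ m" by (simp add: R power2_eq_square flip: power_mult_distrib)
      then have "(real R)\<^sup>2 * \<rho> ^ m = q ^ m" by (simp add: \<rho>_def power_divide)
      also have "\<dots> = sqrt ((2 ^ ?d) ^ m)" by (simp add: q_def real_sqrt_power)
      also have "(2 ^ ?d) ^ m = real R ^ ?d" by (simp add: R power_mult[symmetric] mult.commute)
      finally show ?thesis .
    qed
    also have "L * (4 * C1 + 2) * 5 * sqrt (real R ^ ?d)
        = K * (4 * C1 + 2) * 5 * (sqrt (real R ^ (3 * ?d)) * sqrt (real R ^ ?d))"
      by (simp add: L_def)
    also have "sqrt (real R ^ (3 * ?d)) * sqrt (real R ^ ?d) = real R ^ (2 * ?d)"
    proof -
      have "real R ^ (3 * ?d) * real R ^ ?d = (real R ^ (2 * ?d))\<^sup>2"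
        by (simp flip: power_add power_mult)
      then show ?thesis by (simp flip: real_sqrt_mult)
    qed
    finally show "(\<Sum>j\<in>{- int (R\<^sup>2)<..<int (R\<^sup>2)}. norm (theta Q M R (\<sigma> * of_int j / (real R)\<^sup>2)))
      \<le> K * (4 * C1 + 2) * 5 * real R ^ (2 * ?d)"
      by (simp add: I_def s_def)
  qed
qed

text \<open>The detection inequality carries R^4 R^d on the left and R^2 R^(2d) on the right, up to
  constants. Dividing leaves R^(d-2).\<close>

lemma card_shell_le:
  fixes Q :: "real^'n^'n"
  assumes "CARD('n) \<ge> 5" "symmetric_matrix Q" "a < b"
    and block: "\<And>i j. (i \<in> S) \<noteq> (j \<in> S) \<Longrightarrow> Q $ i $ j = 0"
    and definite: "\<And>u. u \<noteq> 0 \<Longrightarrow> block_vector S u \<Longrightarrow> quad Q u \<noteq> 0"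
  obtains C where "C > 0" "\<And>m R. R = 2 ^ m \<Longrightarrow>
    real (card {x \<in> grid {- int R..int R}. a \<le> quad Q (x - M) \<and> quad Q (x - M) \<le> b}) * (real R)\<^sup>2
      \<le> C * real R ^ CARD('n)"
proof -
  let ?d = "CARD('n)"
  define \<sigma> where "\<sigma> = 1 / (pi * (b - a))"
  have \<sigma>: "\<sigma> > 0" using assms(3) by (simp add: \<sigma>_def)
  obtain C where C: "C > 0" "\<And>m R. R = 2 ^ m \<Longrightarrow>
    (\<Sum>j\<in>{- int (R\<^sup>2)<..<int (R\<^sup>2)}. norm (theta Q M R (\<sigma> * of_int j / (real R)\<^sup>2))) \<le> C * real R ^ (2 * ?d)"
    by (rule sum_theta_le[OF assms(1,2) \<sigma> block definite, where M=M]) (assumption | rule that)+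
  show thesis
  proof (rule that[of "4 * C"])
    show "4 * C > 0" using C by simp
  next
    fix m R :: nat assume R: "R = 2 ^ m"
    let ?n = "real (card {x \<in> (grid {- int R..int R} :: (real^'n) set). a \<le> quad Q (x - M) \<and> quad Q (x - M) \<le> b})"
    have R0: "R > 0" by (simp add: R)
    have dd: "real R ^ (2 * ?d) = real R ^ ?d * real R ^ ?d" by (simp add: mult_2 power_add)
    have "(real (R\<^sup>2))\<^sup>2 / 4 * real R ^ ?d * ?n \<le> (real (R\<^sup>2))\<^sup>2 / 4 * real (2 * R + 1) ^ ?d * ?n"
      by (intro mult_right_mono mult_left_mono power_mono) auto
    also have "\<dots> \<le> real (R\<^sup>2) * (C * real R ^ (2 * ?d))"
      by (rule order.trans[OF card_shell_le_sum_theta[OF assms(3) R0 \<sigma>_def]])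
         (intro mult_left_mono C(2)[OF R], simp)
    finally have "((real R)\<^sup>2 / 4 * real R ^ ?d) * (?n * (real R)\<^sup>2) \<le> ((real R)\<^sup>2 / 4 * real R ^ ?d) * (4 * C * real R ^ ?d)"
      unfolding dd by (simp add: power2_eq_square mult_ac)
    then show "?n * (real R)\<^sup>2 \<le> 4 * C * real R ^ ?d"
      using R0 by (subst (asm) mult_le_cancel_left_pos) auto
  qed
qed

section \<open>A lower bound for the volume\<close>

lemma continuous_on_quad [continuous_intros]:
  "continuous_on A f \<Longrightarrow> continuous_on A (\<lambda>x. quad Q (f x))"
  unfolding quad_def
  by (intro continuous_on_inner bounded_linear.continuous_on[OF matrix_vector_mul_bounded_linear])

lemma lmeasurable_quad_shell:
  fixes Q :: "real^'n^'n"
  shows "{x. a \<le> quad Q x \<and> quad Q x \<le> b \<and> norm x \<le> r} \<in> lmeasurable"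
proof (rule lmeasurable_compact)
  have "{x. a \<le> quad Q x \<and> quad Q x \<le> b \<and> norm x \<le> r}
      = cball 0 r \<inter> ({x. a \<le> quad Q x} \<inter> {x. quad Q x \<le> b})" by auto
  also have "compact \<dots>"
    by (intro compact_Int_closed compact_cball closed_Int closed_Collect_le continuous_intros)
  finally show "compact {x. a \<le> quad Q x \<and> quad Q x \<le> b \<and> norm x \<le> r}" .
qed

lemma lmeasurable_shell:
  fixes Q :: "real^'n^'n"
  shows "shell Q a b M r \<in> lmeasurable"
proof (rule lmeasurable_compact)
  have eq: "shell Q a b M r
      = {x. infnorm x \<le> r} \<inter> ({x. a \<le> quad Q (x - M)} \<inter> {x. quad Q (x - M) \<le> b})"
    by (auto simp: shell_def)
  have "bounded {x::real^'n. infnorm x \<le> r}"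
    unfolding bounded_iff
  proof (intro exI ballI)
    fix x :: "real^'n" assume "x \<in> {x. infnorm x \<le> r}"
    then have "sqrt DIM(real^'n) * infnorm x \<le> sqrt DIM(real^'n) * r" by (intro mult_left_mono) auto
    then show "norm x \<le> sqrt DIM(real^'n) * r" using norm_le_infnorm[of x] by linarith
  qed
  moreover have "closed {x::real^'n. infnorm x \<le> r}"
    by (intro closed_Collect_le continuous_intros)
  ultimately have "compact {x::real^'n. infnorm x \<le> r}" by (simp add: compact_eq_bounded_closed)
  then show "compact (shell Q a b M r)"
    unfolding eq by (intro compact_Int_closed closed_Int closed_Collect_le continuous_intros)
qed

lemma quad_along_line:
  assumes "symmetric_matrix Q"
  shows "quad Q (y + t *\<^sub>R e) = quad Q y + t\<^sup>2 * quad Q e + 2 * t * ((Q *v y) \<bullet> e)"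
  by (simp add: quad_add[OF assms] quad_scaleR)

text \<open>Every line in direction \<open>e\<close> through a point near
  \<open>\<rho> *\<^sub>R f\<close> crosses the shell, and on a mesh of width comparable to 1/rho
  some mesh point lands in it. Hence O(rho^2) translates of the shell cover a ball of radius
  comparable to rho. The normalization gives Q[f] = -1 and Q[f + e] = 1, opposite signs at the two
  ends of the segment.\<close>

lemma measure_quad_shell_ge:
  fixes Q :: "real^'n^'n" and e f :: "real^'n"
  assumes sym: "symmetric_matrix Q" and ab: "a < b"
    and ef: "quad Q e = 2" "quad Q f = -1" "(Q *v f) \<bullet> e = 0"
  obtains c K \<rho>0 where "c > 0" "K > 0" "\<And>\<rho>. \<rho> \<ge> \<rho>0 \<Longrightarrow>
    c * \<rho> ^ CARD('n) \<le> measure lebesgue {x. a \<le> quad Q x \<and> quad Q x \<le> b \<and> norm x \<le> K * \<rho>} * \<rho>\<^sup>2"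
proof -
  obtain B where B: "B > 0" "\<And>x. norm (Q *v x) \<le> B * norm x"
    using matrix_vector_bound by metis
  have fe: "quad Q (f + e) = 1" using quad_add[OF sym, of f e] ef by simp
  have tend: "(quad Q \<longlongrightarrow> quad Q x) (nhds x)" for x
    using continuous_on_quad[of UNIV "\<lambda>x. x" Q]
    by (simp add: continuous_on_eq_continuous_at isCont_def tendsto_at_iff_tendsto_nhds)
  have ev: "\<forall>\<^sub>F y in nhds f. quad Q y < -1/2" "\<forall>\<^sub>F y in nhds (f + e). 1/2 < quad Q y"
    using order_tendstoD(2)[OF tend[of f], of "-1/2"] order_tendstoD(1)[OF tend[of "f + e"], of "1/2"] fe ef(2)
    by simp_all
  obtain \<kappa>1 where \<kappa>1: "\<kappa>1 > 0" "\<And>y. dist y f < \<kappa>1 \<Longrightarrow> quad Q y < -1/2"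
    using ev(1) unfolding eventually_nhds_metric by blast
  obtain \<kappa>2 where \<kappa>2: "\<kappa>2 > 0" "\<And>y. dist y (f + e) < \<kappa>2 \<Longrightarrow> 1/2 < quad Q y"
    using ev(2) unfolding eventually_nhds_metric by blast
  define \<kappa> where "\<kappa> = min \<kappa>1 \<kappa>2"
  have \<kappa>: "\<kappa> > 0" using \<kappa>1 \<kappa>2 by (simp add: \<kappa>_def)
  define D where "D = 2 * B * (norm f + \<kappa>) * norm e + 4"
  define K where "K = norm f + \<kappa> + norm e"
  define v where "v = measure lborel (ball (0::real^'n) 1)"
  \<comment> \<open>From here on |a| + |b| <= rho^2/2, so the end values of the form along the
    segment enclose (a + b)/2.\<close>
  define \<rho>0 where "\<rho>0 = 1 + 2 * (\<bar>a\<bar> + \<bar>b\<bar>)"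
  define G where "G = 2 * D / (b - a) + 1"
  have v: "v > 0" unfolding v_def by (rule content_ball_pos) simp
  have D: "D \<ge> 4" using B(1) \<kappa> by (simp add: D_def)
  have K: "K > 0" using \<kappa> by (simp add: K_def add_pos_nonneg add_nonneg_pos)
  have G: "G > 0" using D ab by (simp add: G_def add_nonneg_pos)
  show thesis
  proof (rule that[of "\<kappa> ^ CARD('n) * v / G" K \<rho>0])
    show "0 < \<kappa> ^ CARD('n) * v / G" using \<kappa> v G by simp
    show "K > 0" by (rule K)
  next
    fix \<rho> :: real assume \<rho>_ge: "\<rho> \<ge> \<rho>0"
    define A where "A = {x. a \<le> quad Q x \<and> quad Q x \<le> b \<and> norm x \<le> K * \<rho>}"
    \<comment> \<open>\<open>D * \<rho>\<close> bounds the rate of change of the form along the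
      segment, so one mesh step changes it by at most (b - a)/2.\<close>
    define \<eta> where "\<eta> = (b - a) / (2 * D * \<rho>)"
    define n where "n = nat \<lfloor>\<rho> / \<eta>\<rfloor>"
    have \<rho>: "\<rho> \<ge> 1" using \<rho>_ge by (simp add: \<rho>0_def)
    have \<rho>2: "\<bar>a\<bar> + \<bar>b\<bar> \<le> \<rho>\<^sup>2 / 2"
    proof -
      have "\<rho> * 1 \<le> \<rho> * \<rho>" using \<rho> by (intro mult_left_mono) auto
      then show ?thesis using \<rho>_ge by (simp add: \<rho>0_def power2_eq_square)
    qed
    have \<eta>: "\<eta> > 0" using ab D \<rho> by (simp add: \<eta>_def)
    have cover: "ball (\<rho> *\<^sub>R f) (\<kappa> * \<rho>) \<subseteq> (\<Union>i\<in>{..n}. (\<lambda>z. z - (real i * \<eta>) *\<^sub>R e) ` A)"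
    proof
      fix y assume y: "y \<in> ball (\<rho> *\<^sub>R f) (\<kappa> * \<rho>)"
      define y' where "y' = y /\<^sub>R \<rho>"
      have yy: "y = \<rho> *\<^sub>R y'" using \<rho> by (simp add: y'_def)
      have "dist y (\<rho> *\<^sub>R f) = \<rho> * dist y' f" using \<rho>
        by (simp add: yy dist_norm flip: scaleR_diff_right)
      then have "\<rho> * dist y' f < \<rho> * \<kappa>" using y by (simp add: dist_commute mult.commute)
      then have y': "dist y' f < \<kappa>" using \<rho> by simp
      have "quad Q y' < -1/2" using y' \<kappa>1(2) by (simp add: \<kappa>_def)
      then have "\<rho>\<^sup>2 * quad Q y' \<le> \<rho>\<^sup>2 * (-1/2)" by (intro mult_left_mono) auto
      then have lo: "quad Q y \<le> - (\<rho>\<^sup>2 / 2)" by (simp add: yy quad_scaleR)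
      have "dist (y' + e) (f + e) < \<kappa>" using y' by simp
      then have "1/2 < quad Q (y' + e)" using \<kappa>2(2) by (simp add: \<kappa>_def)
      then have "\<rho>\<^sup>2 * (1/2) \<le> \<rho>\<^sup>2 * quad Q (y' + e)" by (intro mult_left_mono) auto
      then have hi: "\<rho>\<^sup>2 / 2 \<le> quad Q (y + \<rho> *\<^sub>R e)"
        by (simp add: yy flip: quad_scaleR scaleR_add_right)
      have "norm y' \<le> norm f + \<kappa>"
        using norm_triangle_sub[of y' f] y' by (simp add: dist_norm)
      then have ny: "norm y \<le> (norm f + \<kappa>) * \<rho>"
        using \<rho> by (simp add: yy mult.commute mult_left_mono)
      define \<phi> where "\<phi> = (\<lambda>t. quad Q (y + t *\<^sub>R e))"
      have "continuous_on {0..\<rho>} \<phi>" unfolding \<phi>_def by (intro continuous_intros)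
      moreover have "\<phi> 0 \<le> (a + b) / 2" "(a + b) / 2 \<le> \<phi> \<rho>"
        using lo hi \<rho>2 by (auto simp: \<phi>_def)
      ultimately obtain t where t: "0 \<le> t" "t \<le> \<rho>" "\<phi> t = (a + b) / 2"
        using IVT'[of \<phi> 0 "(a+b)/2" \<rho>] \<rho> by auto
      \<comment> \<open>Aiming at the midpoint (a + b)/2 leaves room (b - a)/2 on both sides when
        \<open>t\<close> is rounded down to a multiple \<open>u\<close> of the mesh.\<close>
      define i where "i = nat \<lfloor>t / \<eta>\<rfloor>"
      define u where "u = real i * \<eta>"
      have i: "real i = of_int \<lfloor>t / \<eta>\<rfloor>" using t \<eta> by (simp add: i_def)
      have "real i \<le> t / \<eta>" "t / \<eta> < real i + 1" unfolding i by linarith+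
      then have u: "u \<le> t" "t - u \<le> \<eta>" "0 \<le> u"
        using \<eta> by (auto simp: u_def pos_le_divide_eq pos_divide_less_eq algebra_simps)
      have "\<phi> t - \<phi> u = (t - u) * (2 * ((Q *v y) \<bullet> e) + 2 * (t + u))"
        by (simp add: \<phi>_def quad_along_line[OF sym] ef(1) power2_eq_square algebra_simps)
      then have "\<bar>\<phi> t - \<phi> u\<bar> = (t - u) * \<bar>2 * ((Q *v y) \<bullet> e) + 2 * (t + u)\<bar>"
        using u by (simp add: abs_mult)
      also have "\<dots> \<le> \<eta> * (D * \<rho>)"
      proof (rule mult_mono)
        define z where "z = (B * ((norm f + \<kappa>) * \<rho>)) * norm e"
        have "\<bar>(Q *v y) \<bullet> e\<bar> \<le> norm (Q *v y) * norm e" by (rule Cauchy_Schwarz_ineq2)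
        also have "\<dots> \<le> (B * ((norm f + \<kappa>) * \<rho>)) * norm e"
          using order.trans[OF B(2)[of y] mult_left_mono[OF ny]] B(1) by (intro mult_right_mono) auto
        also have "\<dots> = z" by (simp only: z_def)
        finally have "\<bar>(Q *v y) \<bullet> e\<bar> \<le> z" .
        then have "2 * \<bar>(Q *v y) \<bullet> e\<bar> \<le> 2 * z" by simp
        moreover have "2 * (t + u) \<le> 4 * \<rho>" using t(2) u(1) by simp
        moreover have "\<bar>2 * ((Q *v y) \<bullet> e) + 2 * (t + u)\<bar> \<le> 2 * \<bar>(Q *v y) \<bullet> e\<bar> + 2 * (t + u)"
          using t(1) u(3) by (intro order.trans[OF abs_triangle_ineq]) (simp add: abs_mult)
        ultimately have "\<bar>2 * ((Q *v y) \<bullet> e) + 2 * (t + u)\<bar> \<le> 2 * z + 4 * \<rho>"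
          by (meson add_mono order_trans)
        also have "\<dots> = D * \<rho>" by (simp add: D_def z_def algebra_simps)
        finally show "\<bar>2 * ((Q *v y) \<bullet> e) + 2 * (t + u)\<bar> \<le> D * \<rho>" .
      qed (use u \<eta> D \<rho> in auto)
      also have "\<dots> = (b - a) / 2" using D \<rho> by (simp add: \<eta>_def)
      finally have "\<bar>\<phi> t - \<phi> u\<bar> \<le> (b - a) / 2" .
      then have "a \<le> \<phi> u" "\<phi> u \<le> b" using t(3) by (simp_all add: field_simps abs_le_iff)
      moreover have "norm (y + u *\<^sub>R e) \<le> K * \<rho>"
      proof -
        have "norm (y + u *\<^sub>R e) \<le> norm y + u * norm e"
          using norm_triangle_ineq[of y "u *\<^sub>R e"] u by simp
        also have "u * norm e \<le> \<rho> * norm e" using u t by (intro mult_right_mono) auto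
        finally show ?thesis using ny by (simp add: K_def algebra_simps)
      qed
      ultimately have "y + u *\<^sub>R e \<in> A" by (simp add: A_def \<phi>_def)
      then have "y \<in> (\<lambda>z. z - (real i * \<eta>) *\<^sub>R e) ` A"
        by (intro image_eqI[of _ _ "y + u *\<^sub>R e"]) (auto simp: u_def)
      moreover have "i \<le> n"
        unfolding i_def n_def using t \<eta> by (intro nat_mono floor_mono divide_right_mono) auto
      ultimately show "y \<in> (\<Union>i\<in>{..n}. (\<lambda>z. z - (real i * \<eta>) *\<^sub>R e) ` A)" by blast
    qed
    have meas: "A \<in> lmeasurable" unfolding A_def by (rule lmeasurable_quad_shell)
    have "(\<kappa> * \<rho>) ^ CARD('n) * v = measure lebesgue (ball (\<rho> *\<^sub>R f) (\<kappa> * \<rho>))"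
      using \<kappa> \<rho> content_ball_conv_unit_ball[of "\<kappa> * \<rho>" "\<rho> *\<^sub>R f"] by (simp add: v_def)
    also have "\<dots> \<le> measure lebesgue (\<Union>i\<in>{..n}. (\<lambda>z. z - (real i * \<eta>) *\<^sub>R e) ` A)"
      by (intro measure_mono_fmeasurable[OF cover] fmeasurable.finite_UN measurable_translation_subtract meas) auto
    also have "\<dots> \<le> (\<Sum>i\<le>n. measure lebesgue ((\<lambda>z. z - (real i * \<eta>) *\<^sub>R e) ` A))"
      by (intro measure_UNION_le fmeasurableD measurable_translation_subtract meas) auto
    also have "\<dots> = (real n + 1) * measure lebesgue A"
      by (simp add: measure_translation_subtract)
    also have "\<dots> \<le> (G * \<rho>\<^sup>2) * measure lebesgue A"
    proof (rule mult_right_mono)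
      have "real n \<le> \<rho> / \<eta>" using \<eta> \<rho> by (simp add: n_def)
      also have "\<dots> = 2 * D / (b - a) * \<rho>\<^sup>2" by (simp add: \<eta>_def power2_eq_square)
      finally have "real n \<le> 2 * D / (b - a) * \<rho>\<^sup>2" .
      moreover have "1 \<le> \<rho>\<^sup>2" using \<rho> by (simp add: one_le_power)
      ultimately show "real n + 1 \<le> G * \<rho>\<^sup>2" unfolding G_def distrib_right by linarith
    qed simp
    finally have "\<kappa> ^ CARD('n) * v * \<rho> ^ CARD('n) \<le> G * (measure lebesgue A * \<rho>\<^sup>2)"
      by (simp add: power_mult_distrib mult_ac)
    then show "\<kappa> ^ CARD('n) * v / G * \<rho> ^ CARD('n)
        \<le> measure lebesgue {x. a \<le> quad Q x \<and> quad Q x \<le> b \<and> norm x \<le> K * \<rho>} * \<rho>\<^sup>2"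
      using G by (simp add: A_def pos_divide_le_eq mult_ac)
  qed
qed

lemma measure_shell_ge:
  fixes Q :: "real^'n^'n" and e f :: "real^'n"
  assumes sym: "symmetric_matrix Q" and ab: "a < b"
    and ef: "quad Q e > 0" "quad Q f < 0" "(Q *v f) \<bullet> e = 0"
  obtains c r0 where "c > 0" "\<And>r. r \<ge> r0 \<Longrightarrow>
    c * r ^ CARD('n) \<le> measure lebesgue (shell Q a b M r) * r\<^sup>2"
proof -
  define e' where "e' = sqrt (2 / quad Q e) *\<^sub>R e"
  define f' where "f' = sqrt (1 / - quad Q f) *\<^sub>R f"
  have "quad Q e' = 2" "quad Q f' = -1" "(Q *v f') \<bullet> e' = 0"
    using ef by (simp_all add: e'_def f'_def quad_scaleR matrix_vector_mult_scaleR divide_nonneg_neg)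
  note e'f' = this
  obtain c K \<rho>0 where c: "c > 0" "K > 0" "\<And>\<rho>. \<rho> \<ge> \<rho>0 \<Longrightarrow>
    c * \<rho> ^ CARD('n) \<le> measure lebesgue {x. a \<le> quad Q x \<and> quad Q x \<le> b \<and> norm x \<le> K * \<rho>} * \<rho>\<^sup>2"
    by (rule measure_quad_shell_ge[OF sym ab e'f']) (assumption | rule that)+
  \<comment> \<open>With this \<open>k\<close> the Euclidean ball has radius K k r = r/2. For r >= 2
    |M| its translate by \<open>M\<close> stays inside the maximum-norm ball of radius r.\<close>
  define k where "k = 1 / (2 * K)"
  have k: "k > 0" using c(2) by (simp add: k_def)
  show thesis
  proof (rule that[of "c * k ^ CARD('n) / k\<^sup>2" "max (\<rho>0 / k) (2 * norm M)"])
    show "0 < c * k ^ CARD('n) / k\<^sup>2" using c k by simp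
  next
    fix r assume r: "max (\<rho>0 / k) (2 * norm M) \<le> r"
    let ?A = "{x. a \<le> quad Q x \<and> quad Q x \<le> b \<and> norm x \<le> K * (k * r)}"
    have "\<rho>0 \<le> k * r" using r k by (simp add: pos_divide_le_eq mult.commute)
    then have "c * (k * r) ^ CARD('n) \<le> measure lebesgue ?A * (k * r)\<^sup>2" by (rule c(3))
    also have "measure lebesgue ?A = measure lebesgue ((+) M ` ?A)" by (rule measure_translation[symmetric])
    also have "\<dots> \<le> measure lebesgue (shell Q a b M r)"
    proof (rule measure_mono_fmeasurable)
      show "(+) M ` ?A \<subseteq> shell Q a b M r"
      proof safe
        fix x assume x: "a \<le> quad Q x" "quad Q x \<le> b" "norm x \<le> K * (k * r)"
        have "K * (k * r) = r / 2" using c(2) by (simp add: k_def)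
        then have "norm (M + x) \<le> r" using norm_triangle_ineq[of M x] x(3) r by linarith
        then have "infnorm (M + x) \<le> r" using infnorm_le_norm[of "M + x"] by linarith
        then show "M + x \<in> shell Q a b M r" using x by (simp add: shell_def)
      qed
    qed (auto intro!: fmeasurableD measurable_translation lmeasurable_quad_shell lmeasurable_shell)
    finally have "c * (k * r) ^ CARD('n) \<le> measure lebesgue (shell Q a b M r) * (k * r)\<^sup>2"
      by (simp add: mult_right_mono)
    then show "c * k ^ CARD('n) / k\<^sup>2 * r ^ CARD('n) \<le> measure lebesgue (shell Q a b M r) * r\<^sup>2"
      using k by (simp add: power_mult_distrib pos_divide_le_eq mult_ac)
  qed
qed

section \<open>The discrepancy\<close>

text \<open>For unit vectors of different blocks, Q[x + y] = Q[x] + Q[y], because each of the two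
  forms sees only one of them. By polarization the corresponding entry of \<open>Q\<close> is
  0.\<close>

lemma block_type_split:
  fixes Q :: "real^('n::{finite,linorder})^('n::{finite,linorder})"
  assumes "symmetric_matrix Q" "block_type Q"
  obtains S where
    "\<And>i j. (i \<in> S) \<noteq> (j \<in> S) \<Longrightarrow> Q $ i $ j = 0"
    "\<And>u. u \<noteq> 0 \<Longrightarrow> \<forall>i. i \<notin> S \<longrightarrow> u $ i = 0 \<Longrightarrow> quad Q u > 0"
    "\<And>u. u \<noteq> 0 \<Longrightarrow> \<forall>i\<in>S. u $ i = 0 \<Longrightarrow> quad Q u < 0"
proof -
  obtain d1 and Qp Qm :: "((real, 'n) vec, 'n) vec" where
    dp: "depends_only_on (quad Qp) (first_coords d1)" and
    dm: "depends_only_on (quad Qm) (- first_coords d1)" and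
    pp: "pos_definite_in (quad Qp) (first_coords d1)" and
    pm: "pos_definite_in (quad Qm) (- first_coords d1)" and
    Q: "\<And>x. quad Q x = quad Qp x - quad Qm x"
    using assms(2) unfolding block_type_def by blast
  define S :: "'n set" where "S = first_coords d1"
  have p_eq: "quad Qp x = quad Qp y" if "\<And>i. i \<in> S \<Longrightarrow> x $ i = y $ i" for x y
    using dp that unfolding depends_only_on_def S_def by blast
  have m_eq: "quad Qm x = quad Qm y" if "\<And>i. i \<notin> S \<Longrightarrow> x $ i = y $ i" for x y
    using dm that unfolding depends_only_on_def S_def by blast
  have zero: "quad Qp 0 = 0" "quad Qm 0 = 0" by (simp_all add: quad_def)
  have cross: "Q $ j $ i = 0" if ij: "i \<in> S" "j \<notin> S" for i j
  proof -
    let ?x = "axis i 1 :: (real, 'n) vec" and ?y = "axis j 1 :: (real, 'n) vec"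
    have "i \<noteq> j" using ij by auto
    have "quad Qp (?x + ?y) = quad Qp ?x" "quad Qm (?x + ?y) = quad Qm ?y"
      "quad Qm ?x = quad Qm 0" "quad Qp ?y = quad Qp 0"
      using ij by (auto intro!: p_eq m_eq simp: axis_def)
    then have "quad Q (?x + ?y) = quad Q ?x + quad Q ?y" by (simp add: Q zero)
    then have "(Q *v ?x) \<bullet> ?y = 0" using quad_add[OF assms(1), of ?x ?y] by simp
    then show ?thesis by (simp add: inner_axis matrix_vector_mult_basis column_def)
  qed
  have sym: "Q $ i $ j = Q $ j $ i" for i j
    using assms(1) unfolding symmetric_matrix_def by (metis transpose_def vec_lambda_beta)
  show thesis
  proof (rule that[of S])
    show "Q $ i $ j = 0" if "(i \<in> S) \<noteq> (j \<in> S)" for i j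
      using that cross[of i j] cross[of j i] sym[of i j] by auto
    show "quad Q u > 0" if u: "u \<noteq> 0" "\<forall>i. i \<notin> S \<longrightarrow> u $ i = 0" for u
    proof -
      have "quad Qm u = quad Qm 0" using u(2) by (intro m_eq) auto
      moreover have "\<exists>i\<in>S. u $ i \<noteq> 0" using u by (auto simp: vec_eq_iff)
      then have "quad Qp u > 0" using pp unfolding pos_definite_in_def S_def by blast
      ultimately show ?thesis by (simp add: Q zero)
    qed
    show "quad Q u < 0" if u: "u \<noteq> 0" "\<forall>i\<in>S. u $ i = 0" for u
    proof -
      have "quad Qp u = quad Qp 0" using u(2) by (intro p_eq) auto
      moreover have "\<exists>i\<in>- S. u $ i \<noteq> 0" using u by (auto simp: vec_eq_iff)
      then have "quad Qm u > 0" using pm unfolding pos_definite_in_def S_def by blast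
      ultimately show ?thesis by (simp add: Q zero)
    qed
  qed
qed

lemma shell_eventually_const:
  fixes Q :: "real^'n^'n"
  assumes definite: "\<And>u. u \<noteq> 0 \<Longrightarrow> quad Q u \<noteq> 0"
  obtains r0 where "\<And>r. r \<ge> r0 \<Longrightarrow> shell Q a b M r = shell Q a b M r0"
proof -
  obtain c T and col :: "real^'n \<Rightarrow> real^'n" where c: "c > 0"
    "\<And>u v. u \<noteq> 0 \<Longrightarrow> v \<noteq> 0 \<Longrightarrow> block_vector UNIV u \<Longrightarrow> block_vector UNIV v \<Longrightarrow> col u = col v \<Longrightarrow>
      c * norm u * norm v \<le> \<bar>(Q *v u) \<bullet> v\<bar>"
    by (rule definite_cone_cover[of UNIV Q]) (use definite in auto)
  \<comment> \<open>With the block \<open>UNIV\<close> every vector is a block vector, and taking v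
    = u in the cone estimate turns it into coercivity.\<close>
  have coercive: "c * (norm u)\<^sup>2 \<le> \<bar>quad Q u\<bar>" for u
    using c(2)[of u u] by (cases "u = 0") (auto simp: block_vector_def quad_def power2_eq_square mult_ac)
  define r0 where "r0 = norm M + sqrt ((\<bar>a\<bar> + \<bar>b\<bar>) / c)"
  have "infnorm x \<le> r0" if "a \<le> quad Q (x - M)" "quad Q (x - M) \<le> b" for x
  proof -
    have "c * (norm (x - M))\<^sup>2 \<le> \<bar>a\<bar> + \<bar>b\<bar>" using coercive[of "x - M"] that by linarith
    then have "(norm (x - M))\<^sup>2 \<le> (\<bar>a\<bar> + \<bar>b\<bar>) / c" using c(1) by (simp add: pos_le_divide_eq mult.commute)
    then have "norm (x - M) \<le> sqrt ((\<bar>a\<bar> + \<bar>b\<bar>) / c)" by (rule real_le_rsqrt)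
    moreover have "norm x \<le> norm M + norm (x - M)" by (rule norm_triangle_sub)
    ultimately show ?thesis using infnorm_le_norm[of x] by (simp add: r0_def)
  qed
  then have "shell Q a b M r = {x. a \<le> quad Q (x - M) \<and> quad Q (x - M) \<le> b}" if "r \<ge> r0" for r
    using that unfolding shell_def by force
  then show ?thesis using that[of r0] by simp
qed

theorem theorem2p1:
  fixes Q :: "real^('n::{finite,linorder})^('n::{finite,linorder})" and M :: "real^('n::{finite,linorder})" and a b :: real
  assumes "CARD('n) \<ge> 5"
    and "symmetric_matrix Q" and "nondegenerate Q" and "block_type Q"
    and "a < b"
  shows "(\<lambda>r. discrepancy Q a b M r) \<in> O[at_top](\<lambda>_. 1)"
proof -
  obtain S where block: "\<And>i j. (i \<in> S) \<noteq> (j \<in> S) \<Longrightarrow> Q $ i $ j = 0"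
    and pos: "\<And>u. u \<noteq> 0 \<Longrightarrow> \<forall>i. i \<notin> S \<longrightarrow> u $ i = 0 \<Longrightarrow> quad Q u > 0"
    and neg: "\<And>u. u \<noteq> 0 \<Longrightarrow> \<forall>i\<in>S. u $ i = 0 \<Longrightarrow> quad Q u < 0"
    by (rule block_type_split[OF assms(2,4)]) (assumption | rule that)+
  show ?thesis
  proof (cases "S = {} \<or> S = UNIV")
    \<comment> \<open>The form is definite, so the discrepancy is eventually constant and is bounded
      by its own final value. This also covers a shell of volume 0, where division by 0 yields
      0.\<close>
    case True
    have definite: "quad Q u \<noteq> 0" if "u \<noteq> 0" for u
      using True pos[OF that] neg[OF that] by auto
    obtain r0 where r0: "\<And>r. r \<ge> r0 \<Longrightarrow> shell Q a b M r = shell Q a b M r0"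
      by (rule shell_eventually_const[OF definite, where a=a and b=b and M=M]) (assumption | rule that)+
    show ?thesis
    proof (rule bigoI)
      show "\<forall>\<^sub>F r in at_top. norm (discrepancy Q a b M r) \<le> \<bar>discrepancy Q a b M r0\<bar> * norm (1::real)"
        using eventually_ge_at_top[of r0]
      proof eventually_elim
        case (elim r)
        then show ?case using r0[OF elim] by (simp add: discrepancy_def)
      qed
    qed
  next
    case False
    then obtain i j where ij: "i \<in> S" "j \<notin> S" by auto
    have definite: "quad Q u \<noteq> 0" if "u \<noteq> 0" "block_vector S u" for u
      using that pos[of u] neg[of u] unfolding block_vector_def by force
    obtain C where C: "C > 0" "\<And>m R. R = 2 ^ m \<Longrightarrow>
      real (card {x \<in> grid {- int R..int R}. a \<le> quad Q (x - M) \<and> quad Q (x - M) \<le> b}) * (real R)\<^sup>2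
        \<le> C * real R ^ CARD('n)"
      by (rule card_shell_le[OF assms(1,2,5) block definite, where M=M]) (assumption | rule that)+
    \<comment> \<open>One coordinate vector from each block provides the orthogonal directions of
      opposite sign for the volume bound.\<close>
    have e: "quad Q (axis i 1) > 0" using ij by (intro pos) (simp add: axis_eq_0_iff, auto simp: axis_def)
    have f: "quad Q (axis j 1) < 0" using ij by (intro neg) (simp add: axis_eq_0_iff, auto simp: axis_def)
    have ef: "(Q *v axis j 1) \<bullet> axis i 1 = 0"
      using block[of i j] ij by (simp add: inner_axis matrix_vector_mult_basis column_def)
    obtain c r0 where c: "c > 0" "\<And>r. r \<ge> r0 \<Longrightarrow>
        c * r ^ CARD('n) \<le> measure lebesgue (shell Q a b M r) * r\<^sup>2"
      by (rule measure_shell_ge[OF assms(2,5) e f ef, where M=M]) (assumption | rule that)+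
    show ?thesis
    proof (rule bigoI)
      show "\<forall>\<^sub>F r in at_top. norm (discrepancy Q a b M r) \<le> (C * 2 ^ CARD('n) / c + 1) * norm (1::real)"
        using eventually_ge_at_top[of "max r0 1"]
      proof eventually_elim
        case (elim r)
        then have r: "r \<ge> r0" "r \<ge> 1" by auto
        define n where "n = real (card (shell Q a b M r \<inter> integer_points))"
        define v where "v = measure lebesgue (shell Q a b M r)"
        obtain l where l: "2 ^ l \<le> r" "r < 2 ^ Suc l" using dyadic_bracket[OF r(2)] by blast
        \<comment> \<open>The counting bound is available for powers of two. One of them lies
          between r and 2r, at the cost of a factor 2^d.\<close>
        define R where "R = (2::nat) ^ Suc l"
        have R: "r \<le> real R" "real R \<le> 2 * r" using l by (simp_all add: R_def)
        have "shell Q a b M r \<inter> integer_points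
            \<subseteq> {x \<in> grid {- int R..int R}. a \<le> quad Q (x - M) \<and> quad Q (x - M) \<le> b}"
        proof
          fix x assume x: "x \<in> shell Q a b M r \<inter> integer_points"
          have "\<bar>x $ k\<bar> \<le> real R" for k
            using x component_le_infnorm_cart[of x k] R(1) by (auto simp: shell_def)
          then show "x \<in> {x \<in> grid {- int R..int R}. a \<le> quad Q (x - M) \<and> quad Q (x - M) \<le> b}"
            using x by (simp add: grid_symmetric_iff shell_def)
        qed
        then have "n \<le> real (card {x \<in> (grid {- int R..int R} :: (real, 'n) vec set). a \<le> quad Q (x - M) \<and> quad Q (x - M) \<le> b})"
          unfolding n_def by (intro of_nat_mono card_mono) (simp_all add: finite_grid)
        then have "n * r\<^sup>2 \<le> real (card {x \<in> (grid {- int R..int R} :: (real, 'n) vec set). a \<le> quad Q (x - M) \<and> quad Q (x - M) \<le> b}) * (real R)\<^sup>2"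
          using R(1) r(2) by (intro mult_mono power_mono) auto
        also have "\<dots> \<le> C * real R ^ CARD('n)" by (rule C(2)[OF R_def])
        also have "\<dots> \<le> C * (2 * r) ^ CARD('n)"
          using C(1) R(2) by (intro mult_left_mono power_mono) auto
        also have "\<dots> = C * 2 ^ CARD('n) / c * (c * r ^ CARD('n))"
          using c(1) by (simp add: power_mult_distrib)
        also have "\<dots> \<le> C * 2 ^ CARD('n) / c * (v * r\<^sup>2)"
          unfolding v_def using C(1) c(1) by (intro mult_left_mono c(2)[OF r(1)]) auto
        finally have "n * r\<^sup>2 \<le> (C * 2 ^ CARD('n) / c * v) * r\<^sup>2" by (simp add: mult.assoc)
        then have nv: "n \<le> C * 2 ^ CARD('n) / c * v"
          by (rule mult_right_le_imp_le) (use r(2) in simp)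
        have "0 < c * r ^ CARD('n)" using c(1) r(2) by simp
        then have "0 < v * r\<^sup>2" using c(2)[OF r(1)] by (simp add: v_def)
        \<comment> \<open>Positivity of the volume makes the quotient genuine, so that n <= const *
          v bounds the discrepancy.\<close>
        then have v: "v > 0" using r(2) by (simp add: zero_less_mult_iff)
        have "discrepancy Q a b M r = \<bar>n - v\<bar> / v"
          using v by (simp add: discrepancy_def n_def v_def)
        also have "\<dots> \<le> (n + v) / v"
          using v by (intro divide_right_mono) (auto simp: n_def)
        also have "\<dots> = n / v + 1" using v by (simp add: add_divide_distrib)
        also have "\<dots> \<le> C * 2 ^ CARD('n) / c + 1" using nv v by (simp add: pos_divide_le_eq)
        finally show ?case by (simp add: discrepancy_def)
      qed
    qed
  qed
qed

end
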